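(* Let $k \geq 1$ be an integer, let $\mathsf{q} \in \mathbb{C}$ be nonzero and not a root of unity, and let $\mathsf{V}_{\mathsf{q}} = \mathbb{C}x \oplus \mathbb{C}y$ be the natural two-dimensional module of the quantum enveloping algebra $\mathsf{U}_{\mathsf{q}} = \mathsf{U}_{\mathsf{q}}(\mathfrak{gl}(1|1))$. For each subset $\mathsf{s} \subseteq \{1,\dots,k-1\}$ let $\mathsf{V}_{\mathsf{q},\mathsf{s}} = \mathrm{span}_{\mathbb{C}}\{v_{\mathsf{s}}, Fv_{\mathsf{s}}\} \subseteq \mathsf{V}_{\mathsf{q}}^{\otimes k}$, where $v_{\mathsf{s}} = E(y \otimes u_{\mathsf{s}})$ and $u_{\mathsf{s}} = u_1 \otimes \cdots \otimes u_{k-1}$ with $u_i = x$ if $i \in \mathsf{s}$ and $u_i = y$ if $i \notin \mathsf{s}$. Then $$\mathsf{V}_{\mathsf{q}}^{\otimes k} = \bigoplus_{\mathsf{s} \subseteq \{1,\dots,k-1\}} \mathsf{V}_{\mathsf{q},\mathsf{s}} \;\cong\; \bigoplus_{\ell=0}^{k-1} \binom{k-1}{\ell}\, \mathsf{L}_{\mathsf{q}}[\ell+1,\,k-1-\ell]$$ affords a decomposition of $\mathsf{V}_{\mathsf{q}}^{\otimes k}$ into irreducible $\mathsf{U}_{\mathsf{q}}$-modules. Here $\binom{k-1}{\ell}\mathsf{L}_{\mathsf{q}}[\ell+1,k-1-\ell]$ denotes a direct sum of $\binom{k-1}{\ell}$ copies of $\mathsf{L}_{\mathsf{q}}[\ell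+1,k-1-\ell]$.
   Context: Let $\mathsf{P} = \mathbb{Z}\varepsilon_1 \oplus \mathbb{Z}\varepsilon_2$ and let $\mathsf{P}^* = \mathbb{Z}h_1 \oplus \mathbb{Z}h_2$ be its dual, with pairing $\langle h_i, \varepsilon_j\rangle = \delta_{i,j}$; set $\alpha = \varepsilon_1 - \varepsilon_2$. $\mathsf{U}_{\mathsf{q}} = \mathsf{U}_{\mathsf{q}}(\mathfrak{gl}(1|1))$ is the unital Hopf algebra over $\mathbb{C}$ with generators $E, F, \sigma, q^h$ ($h \in \mathsf{P}^*$) and relations, for all $h,h' \in \mathsf{P}^*$: $q^0 = 1$, $q^hq^{h'} = q^{h+h'}$, $q^hE = \mathsf{q}^{\langle h,\alpha\rangle}Eq^h$, $q^hF = \mathsf{q}^{-\langle h,\alpha\rangle}Fq^h$, $EF + FE = \dfrac{K - K^{-1}}{\mathsf{q} - \mathsf{q}^{-1}}$ where $K = q^{h_1+h_2}$, $E^2 = 0 = F^2$, $\sigma E = -E\sigma$, $\sigma F = -F\sigma$, $\sigma q^h = q^h\sigma$, $\sigma^2 = 1$. The coproduct is $\Delta(E) = E \otimes K^{-1} + \sigma \otimes E$, $\Delta(F) = F \otimes 1 + \sigma K \otimes F$, $\Delta(q^h) = q^h \otimes q^h$, $\Delta(\sigma) = \sigma \otimes \sigma$; it gives the action of $\mathsf{U}_{\mathsf{q}}$ on tensor products of modules. The natural module $\mathsf{V}_{\mathsf{q}} = \mathbb{C}x \oplus \mathbb{C}y$ has action $Ex = 0$, $Ey = x$, $Fx = y$,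 $Fy = 0$, $q^hx = \mathsf{q}^{\langle h,\varepsilon_1\rangle}x$, $q^hy = \mathsf{q}^{\langle h,\varepsilon_2\rangle}y$, $\sigma x = x$, $\sigma y = -y$. Thus $v_{\mathsf{s}} = E(y \otimes u_{\mathsf{s}}) = \mathsf{q}^{1-k}\,x \otimes u_{\mathsf{s}} - y \otimes Eu_{\mathsf{s}}$. (For $k=1$, the only subset is $\mathsf{s} = \emptyset$ and $v_\emptyset = Ey = x$.) $\mathsf{L}_{\mathsf{q}}[m,n]$ denotes the finite-dimensional irreducible $\mathsf{U}_{\mathsf{q}}$-module with highest weight $[\mathsf{q}^m, \mathsf{q}^n]$ relative to $q^{h_1}, q^{h_2}$, i.e. containing a nonzero vector $w$ with $Ew = 0$, $q^{h_1}w = \mathsf{q}^mw$, $q^{h_2}w = \mathsf{q}^nw$.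
   Formalization: L_q[m,n] is taken with the extra condition that σ acts on the highest weight vector w by (-1)^n; the weights under q^{h_1}, q^{h_2} alone leave two non-isomorphic modules (σ and -σ), and only this one gives the stated isomorphism. *)

theory Defs
  imports Complex_Main "HOL-Library.FuncSet" "HOL-Library.Function_Algebras"
    "HOL-Library.Product_Plus"
begin

text \<open>
  The lattices P and P* are both \<open>int \<times> int\<close>, in the bases
  \<open>\<epsilon>1, \<epsilon>2\<close> and \<open>h1, h2\<close>.
\<close>

definition pairing :: "int \<times> int \<Rightarrow> int \<times> int \<Rightarrow> int" where
  "pairing h l = fst h * fst l + snd h * snd l"

definition eps1 :: "int \<times> int" where "eps1 = (1, 0)"
definition eps2 :: "int \<times> int" where "eps2 = (0, 1)"
definition alpha :: "int \<times> int" where "alpha = eps1 - eps2"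
definition h1 :: "int \<times> int" where "h1 = (1, 0)"
definition h2 :: "int \<times> int" where "h2 = (0, 1)"

datatype Uq_gen = E | F | Sig | Q "int \<times> int"

abbreviation K :: Uq_gen where "K \<equiv> Q (h1 + h2)"
abbreviation Kinv :: Uq_gen where "Kinv \<equiv> Q (- (h1 + h2))"

text \<open>
  The coproduct on generators: each list entry \<open>(a, b)\<close> stands for the
  pure tensor of two words (products of generators, the empty word being 1), and
  the list stands for their sum.
\<close>

fun coproduct :: "Uq_gen \<Rightarrow> (Uq_gen list \<times> Uq_gen list) list" where
  "coproduct E = [([E], [Kinv]), ([Sig], [E])]"
| "coproduct F = [([F], []), ([Sig, K], [F])]"
| "coproduct Sig = [([Sig], [Sig])]"
| "coproduct (Q h) = [([Q h], [Q h])]"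

text \<open>
  As the algebra is given by generators and relations, a module over it is a complex
  vector space with one linear operator for each generator such that the operators
  satisfy the relations.  The vector space is a subspace \<open>uspace M\<close> of a type
  that carries a scalar multiplication \<open>s\<close>; what the operators do
  outside \<open>uspace M\<close> is irrelevant.
\<close>

record 'v Uq_mod =
  uspace :: "'v set"
  act :: "Uq_gen \<Rightarrow> 'v \<Rightarrow> 'v"

definition Uq_module ::
    "complex \<Rightarrow> (complex \<Rightarrow> 'v::ab_group_add \<Rightarrow> 'v) \<Rightarrow> 'v Uq_mod \<Rightarrow> bool" where
  "Uq_module q s M \<longleftrightarrow>
     vector_space s \<and> module.subspace s (uspace M) \<and>
     (\<forall>g. \<forall>v\<in>uspace M. act M g v \<in> uspace M) \<and>
     (\<forall>g. \<forall>v\<in>uspace M. \<forall>w\<in>uspace M. act M g (v + w) = act M g v + act M g w) \<and>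
     (\<forall>g c. \<forall>v\<in>uspace M. act M g (s c v) = s c (act M g v)) \<and>
     (\<forall>v\<in>uspace M.
        act M (Q 0) v = v \<and>
        (\<forall>h h'. act M (Q h) (act M (Q h') v) = act M (Q (h + h')) v) \<and>
        (\<forall>h. act M (Q h) (act M E v)
               = s (q powi pairing h alpha) (act M E (act M (Q h) v))) \<and>
        (\<forall>h. act M (Q h) (act M F v)
               = s (q powi (- pairing h alpha)) (act M F (act M (Q h) v))) \<and>
        act M E (act M F v) + act M F (act M E v)
          = s (1 / (q - inverse q)) (act M K v - act M Kinv v) \<and>
        act M E (act M E v) = 0 \<and>
        act M F (act M F v) = 0 \<and>
        act M Sig (act M E v) = - act M E (act M Sig v) \<and>
        act M Sig (act M F v) = - act M F (act M Sig v) \<and>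
        (\<forall>h. act M Sig (act M (Q h) v) = act M (Q h) (act M Sig v)) \<and>
        act M Sig (act M Sig v) = v)"

definition Uq_irreducible ::
    "complex \<Rightarrow> (complex \<Rightarrow> 'v::ab_group_add \<Rightarrow> 'v) \<Rightarrow> 'v Uq_mod \<Rightarrow> bool" where
  "Uq_irreducible q s M \<longleftrightarrow>
     Uq_module q s M \<and> uspace M \<noteq> {0} \<and>
     (\<forall>W. W \<subseteq> uspace M \<and> module.subspace s W \<and> (\<forall>g. \<forall>v\<in>W. act M g v \<in> W)
          \<longrightarrow> W = {0} \<or> W = uspace M)"

definition Uq_isomorphic ::
    "complex \<Rightarrow> (complex \<Rightarrow> 'v::ab_group_add \<Rightarrow> 'v) \<Rightarrow> 'v Uq_mod
       \<Rightarrow> (complex \<Rightarrow> 'w::ab_group_add \<Rightarrow> 'w) \<Rightarrow> 'w Uq_mod \<Rightarrow> bool" where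
  "Uq_isomorphic q s M t N \<longleftrightarrow>
     Uq_module q s M \<and> Uq_module q t N \<and>
     (\<exists>\<phi>. bij_betw \<phi> (uspace M) (uspace N) \<and>
          (\<forall>v\<in>uspace M. \<forall>w\<in>uspace M. \<phi> (v + w) = \<phi> v + \<phi> w) \<and>
          (\<forall>c. \<forall>v\<in>uspace M. \<phi> (s c v) = t c (\<phi> v)) \<and>
          (\<forall>g. \<forall>v\<in>uspace M. \<phi> (act M g v) = act N g (\<phi> v)))"

text \<open>
  \<open>is_Lq q s m n M\<close>: the module \<open>M\<close> is a copy of
  \<open>L[m,n]\<close>.  Irreducibility and the weights of the highest weight
  vector \<open>w\<close> under \<open>E\<close> and the \<open>Q h\<close> determine
  the module only up to changing the sign of \<open>Sig\<close>, which the
  relations allow.  The sign fixed here is the one found in tensor powers of the natural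
  module, where \<open>Sig\<close> acts on vectors of weight
  \<open>a \<epsilon>1 + b \<epsilon>2\<close> as \<open>(-1)^b\<close>; without that choice,
  \<open>L[m,n]\<close> would not be well defined up to isomorphism.
\<close>

definition is_Lq ::
    "complex \<Rightarrow> (complex \<Rightarrow> 'v::ab_group_add \<Rightarrow> 'v) \<Rightarrow> int \<Rightarrow> int \<Rightarrow> 'v Uq_mod \<Rightarrow> bool" where
  "is_Lq q s m n M \<longleftrightarrow>
     Uq_irreducible q s M \<and>
     (\<exists>B. finite B \<and> B \<subseteq> uspace M \<and> module.span s B = uspace M) \<and>
     (\<exists>w\<in>uspace M. w \<noteq> 0 \<and> act M E w = 0 \<and>
        act M (Q h1) w = s (q powi m) w \<and> act M (Q h2) w = s (q powi n) w \<and>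
        act M Sig w = s ((-1) powi n) w)"

definition external_direct_sum :: "'i set \<Rightarrow> ('i \<Rightarrow> 'v::zero Uq_mod) \<Rightarrow> ('i \<Rightarrow> 'v) Uq_mod" where
  "external_direct_sum I M =
     \<lparr>uspace = {f. (\<forall>i\<in>I. f i \<in> uspace (M i)) \<and> (\<forall>i. i \<notin> I \<longrightarrow> f i = 0) \<and> finite {i. f i \<noteq> 0}},
      act = (\<lambda>g f i. if i \<in> I then act (M i) g (f i) else 0)\<rparr>"

definition external_scale :: "(complex \<Rightarrow> 'v \<Rightarrow> 'v) \<Rightarrow> complex \<Rightarrow> ('i \<Rightarrow> 'v) \<Rightarrow> ('i \<Rightarrow> 'v)" where
  "external_scale s c f = (\<lambda>i. s c (f i))"

text \<open>Every element of \<open>T\<close> is uniquely a sum of elements of the \<open>A i\<close>,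
  for a finite index set \<open>I\<close>.\<close>

definition internal_direct_sum :: "'v::comm_monoid_add set \<Rightarrow> 'i set \<Rightarrow> ('i \<Rightarrow> 'v set) \<Rightarrow> bool" where
  "internal_direct_sum T I A \<longleftrightarrow> bij_betw (\<lambda>w. \<Sum>i\<in>I. w i) (\<Pi>\<^sub>E i\<in>I. A i) T"

definition fscale :: "complex \<Rightarrow> ('a \<Rightarrow> complex) \<Rightarrow> ('a \<Rightarrow> complex)" where
  "fscale c f = (\<lambda>a. c * f a)"

datatype letter = LX | LY

definition xvec :: "letter \<Rightarrow> complex" where "xvec = (\<lambda>a. if a = LX then 1 else 0)"
definition yvec :: "letter \<Rightarrow> complex" where "yvec = (\<lambda>a. if a = LY then 1 else 0)"

text \<open>The natural module; \<open>v LX\<close> and \<open>v LY\<close> are the coordinates of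
  \<open>v\<close> in the basis \<open>x, y\<close>.\<close>

fun natural_act :: "complex \<Rightarrow> Uq_gen \<Rightarrow> (letter \<Rightarrow> complex) \<Rightarrow> (letter \<Rightarrow> complex)" where
  "natural_act q E v = fscale (v LY) xvec"
| "natural_act q F v = fscale (v LX) yvec"
| "natural_act q Sig v = fscale (v LX) xvec - fscale (v LY) yvec"
| "natural_act q (Q h) v =
     fscale (v LX * q powi pairing h eps1) xvec + fscale (v LY * q powi pairing h eps2) yvec"

definition natural_module :: "complex \<Rightarrow> (letter \<Rightarrow> complex) Uq_mod" where
  "natural_module q = \<lparr>uspace = UNIV, act = natural_act q\<rparr>"

text \<open>
  Tensors in coordinates: if \<open>v\<close> has coordinates indexed by
  \<open>'a\<close> and \<open>f\<close> has coordinates indexed by words over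
  \<open>'a\<close>, their tensor product is again indexed by words.  So the
  coordinates of the \<open>k\<close>-th tensor power are indexed by the words of
  length \<open>k\<close>.  The operator \<open>tens_op A B\<close> is the tensor
  product of \<open>A\<close> and \<open>B\<close>: it applies \<open>B\<close> in the
  second factor and then \<open>A\<close> in the first.
\<close>

definition tens :: "('a \<Rightarrow> complex) \<Rightarrow> ('a list \<Rightarrow> complex) \<Rightarrow> ('a list \<Rightarrow> complex)" where
  "tens v f = (\<lambda>w. case w of [] \<Rightarrow> 0 | a # u \<Rightarrow> v a * f u)"

definition tens_op ::
    "(('a \<Rightarrow> complex) \<Rightarrow> ('a \<Rightarrow> complex)) \<Rightarrow> (('a list \<Rightarrow> complex) \<Rightarrow> ('a list \<Rightarrow> complex))
       \<Rightarrow> ('a list \<Rightarrow> complex) \<Rightarrow> ('a list \<Rightarrow> complex)" where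
  "tens_op A B f = (\<lambda>w. case w of [] \<Rightarrow> 0 | a # u \<Rightarrow> A (\<lambda>b. B (\<lambda>u'. f (b # u')) u) a)"

lemma tens_op_tens:
  assumes "\<And>c. A (fscale c v) = fscale c (A v)" and "\<And>c. B (fscale c f) = fscale c (B f)"
  shows "tens_op A B (tens v f) = tens (A v) (B f)"
proof
  fix w
  show "tens_op A B (tens v f) w = tens (A v) (B f) w"
  proof (cases w)
    case Nil
    then show ?thesis by (simp add: tens_op_def tens_def)
  next
    case (Cons a u)
    have "(\<lambda>b. B (\<lambda>u'. tens v f (b # u')) u) = fscale (B f u) v"
      using assms(2) by (simp add: tens_def fscale_def fun_eq_iff)
    then show ?thesis
      using Cons assms(1)[of "B f u"] by (simp add: tens_op_def tens_def fscale_def)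
  qed
qed

definition word_act :: "'v Uq_mod \<Rightarrow> Uq_gen list \<Rightarrow> 'v \<Rightarrow> 'v" where
  "word_act M a v = foldr (act M) a v"

definition tens_module :: "('a \<Rightarrow> complex) Uq_mod \<Rightarrow> ('a list \<Rightarrow> complex) Uq_mod
    \<Rightarrow> ('a list \<Rightarrow> complex) Uq_mod" where
  "tens_module M N =
     \<lparr>uspace = module.span fscale {tens v f | v f. v \<in> uspace M \<and> f \<in> uspace N},
      act = (\<lambda>g f. \<Sum>(a, b)\<leftarrow>coproduct g. tens_op (word_act M a) (word_act N b) f)\<rparr>"

text \<open>The empty tensor, and the trivial module it spans, on which the counit acts.\<close>

definition tens_one :: "'a list \<Rightarrow> complex" where
  "tens_one = (\<lambda>w. if w = [] then 1 else 0)"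

fun trivial_act :: "Uq_gen \<Rightarrow> ('a list \<Rightarrow> complex) \<Rightarrow> ('a list \<Rightarrow> complex)" where
  "trivial_act E f = 0"
| "trivial_act F f = 0"
| "trivial_act Sig f = f"
| "trivial_act (Q h) f = f"

definition trivial_module :: "('a list \<Rightarrow> complex) Uq_mod" where
  "trivial_module = \<lparr>uspace = module.span fscale {tens_one}, act = trivial_act\<rparr>"

fun tensor_power :: "complex \<Rightarrow> nat \<Rightarrow> (letter list \<Rightarrow> complex) Uq_mod" where
  "tensor_power q 0 = trivial_module"
| "tensor_power q (Suc k) = tens_module (natural_module q) (tensor_power q k)"

definition u_vec :: "nat \<Rightarrow> nat set \<Rightarrow> letter list \<Rightarrow> complex" where
  "u_vec k S = foldr tens (map (\<lambda>i. if i \<in> S then xvec else yvec) [1..<k]) tens_one"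

definition v_vec :: "complex \<Rightarrow> nat \<Rightarrow> nat set \<Rightarrow> letter list \<Rightarrow> complex" where
  "v_vec q k S = act (tensor_power q k) E (tens yvec (u_vec k S))"

definition V_sub :: "complex \<Rightarrow> nat \<Rightarrow> nat set \<Rightarrow> (letter list \<Rightarrow> complex) Uq_mod" where
  "V_sub q k S = (tensor_power q k)
     \<lparr>uspace := module.span fscale {v_vec q k S, act (tensor_power q k) F (v_vec q k S)}\<rparr>"

end

theory Submission
  imports Defs
begin

text \<open>
  Write \<open>V\<close> for the natural module, \<open>T\<close> for its \<open>k\<close>-th tensor power and \<open>W\<close> for the
  \<open>(k-1)\<close>-st one, so that \<open>T = x \<otimes> W \<oplus> y \<otimes> W\<close>.  All weights \<open>(a, b)\<close> of \<open>T\<close> have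
  \<open>a + b = k\<close>; hence \<open>K\<close> acts on \<open>T\<close> as the scalar \<open>q^k\<close>, and the relation between \<open>E\<close> and
  \<open>F\<close> becomes \<open>EF + FE = [k]\<close> with the quantum integer \<open>[k]\<close>, which is nonzero because \<open>q\<close> is
  not a root of unity.  Everything follows from this and from \<open>E\<^sup>2 = F\<^sup>2 = 0\<close>.

  \<^item> Every \<open>f\<close> is \<open>[k]\<^sup>-\<^sup>1 (E (F f) + F (E f))\<close>, so \<open>T\<close> is the sum of \<open>E T\<close> and \<open>F (E T)\<close>.  Moreover
    \<open>c \<mapsto> E (y \<otimes> c)\<close> maps \<open>W\<close> onto \<open>E T\<close> (\<open>image_E\<close>) and is injective, since the
    \<open>x\<close>-component of the result is a nonzero multiple of \<open>c\<close>.  Finally, if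
    \<open>E (y \<otimes> a) + F E (y \<otimes> b) = 0\<close>, then applying \<open>E\<close> gives \<open>[k] E (y \<otimes> b) = 0\<close>, so \<open>b = 0\<close> and
    then \<open>a = 0\<close>.  Thus \<open>(a, b) \<mapsto> E (y \<otimes> a) + F E (y \<otimes> b)\<close> is a linear bijection from \<open>W \<times> W\<close>
    to \<open>T\<close>.  As the \<open>u_S\<close> form the standard basis of \<open>W\<close>, the vectors \<open>v_S = E (y \<otimes> u_S)\<close>
    together with the \<open>F v_S\<close> form a basis of \<open>T\<close> (\<open>tensor_power_internal_direct_sum\<close>).

  \<^item> Each \<open>v_S\<close> is a highest weight vector of weight \<open>(|S| + 1, k - 1 - |S|)\<close>.  For a highest weight
    vector \<open>w\<close> of weight \<open>(m, n)\<close> one has \<open>E F w = [m + n] w\<close>, so, when \<open>[m + n]\<close> is nonzero, any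
    nonzero vector of the span of \<open>w\<close> and \<open>F w\<close> generates this span
    (\<open>span_highest_weight_vector\<close>).  The action in the coordinates given by \<open>w\<close> and \<open>F w\<close> depends on
    \<open>(m, n)\<close> only, and so \<open>L[m,n]\<close> is unique up to isomorphism (\<open>Lq_unique\<close>).

  \<^item> Sorting the subsets \<open>S\<close> by cardinality turns the internal direct sum into the external one.
\<close>

section \<open>Modules with a highest weight vector\<close>

text \<open>The quantum integer \<open>[n]\<close>: the value of \<open>EF + FE\<close> on vectors on which \<open>K\<close> acts as \<open>q^n\<close>.\<close>

definition q_number :: "complex \<Rightarrow> int \<Rightarrow> complex" where
  "q_number q n = (q powi n - q powi (- n)) / (q - inverse q)"

definition highest_weight_vector ::
    "complex \<Rightarrow> (complex \<Rightarrow> 'v::ab_group_add \<Rightarrow> 'v) \<Rightarrow> int \<Rightarrow> int \<Rightarrow> 'v Uq_mod \<Rightarrow> 'v \<Rightarrow> bool" where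
  "highest_weight_vector q s m n M w \<longleftrightarrow>
     w \<in> uspace M \<and> w \<noteq> 0 \<and> act M E w = 0 \<and>
     act M (Q h1) w = s (q powi m) w \<and> act M (Q h2) w = s (q powi n) w \<and>
     act M Sig w = s ((-1) powi n) w"

text \<open>
  Using pairs of numbers as coordinates makes modules on different vector spaces comparable.
\<close>

definition weight_comb ::
    "(complex \<Rightarrow> 'v::ab_group_add \<Rightarrow> 'v) \<Rightarrow> 'v Uq_mod \<Rightarrow> 'v \<Rightarrow> complex \<times> complex \<Rightarrow> 'v" where
  "weight_comb s M w p = s (fst p) w + s (snd p) (act M F w)"

text \<open>The action on \<open>L[m,n]\<close>, in the coordinates with respect to \<open>w\<close> and \<open>F w\<close>.\<close>

fun std_act :: "complex \<Rightarrow> int \<Rightarrow> int \<Rightarrow> Uq_gen \<Rightarrow> complex \<times> complex \<Rightarrow> complex \<times> complex" where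
  "std_act q m n E p = (snd p * q_number q (m + n), 0)"
| "std_act q m n F p = (0, fst p)"
| "std_act q m n Sig p = (fst p * (-1) powi n, - (snd p * (-1) powi n))"
| "std_act q m n (Q h) p =
     (fst p * q powi pairing h (m, n), snd p * q powi pairing h (m - 1, n + 1))"

locale quantum_module = vector_space s
  for s :: "complex \<Rightarrow> 'v::ab_group_add \<Rightarrow> 'v" +
  fixes q :: complex and M :: "'v Uq_mod"
  assumes is_module: "Uq_module q s M"
begin

lemma sub_uspace: "subspace (uspace M)"
  using is_module by (simp add: Uq_module_def)

lemma act_closed: "v \<in> uspace M \<Longrightarrow> act M g v \<in> uspace M"
  using is_module by (simp add: Uq_module_def)

lemma act_add: "v \<in> uspace M \<Longrightarrow> w \<in> uspace M \<Longrightarrow> act M g (v + w) = act M g v + act M g w"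
  using is_module by (simp add: Uq_module_def)

lemma act_scale: "v \<in> uspace M \<Longrightarrow> act M g (s c v) = s c (act M g v)"
  using is_module by (simp add: Uq_module_def)

lemma act_zero: "act M g 0 = 0"
  using act_scale[of 0 g 0] subspace_0[OF sub_uspace] by simp

lemma act_neg: "v \<in> uspace M \<Longrightarrow> act M g (- v) = - act M g v"
  using act_scale[of v g "- 1"] by simp

lemma act_diff: "v \<in> uspace M \<Longrightarrow> w \<in> uspace M \<Longrightarrow> act M g (v - w) = act M g v - act M g w"
  using act_add[of v "- w" g] by (simp add: act_neg subspace_neg[OF sub_uspace])

lemma act_sum:
  assumes "\<And>i. i \<in> I \<Longrightarrow> f i \<in> uspace M"
  shows "act M g (\<Sum>i\<in>I. f i) = (\<Sum>i\<in>I. act M g (f i))"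
  using assms
  by (induction I rule: infinite_finite_induct)
    (auto simp: act_zero act_add subspace_sum[OF sub_uspace])

lemma relations:
  assumes "v \<in> uspace M"
  shows Q_0: "act M (Q 0) v = v"
    and Q_Q: "act M (Q h) (act M (Q h') v) = act M (Q (h + h')) v"
    and Q_E: "act M (Q h) (act M E v) = s (q powi pairing h alpha) (act M E (act M (Q h) v))"
    and Q_F: "act M (Q h) (act M F v) = s (q powi (- pairing h alpha)) (act M F (act M (Q h) v))"
    and EF_FE: "act M E (act M F v) + act M F (act M E v)
          = s (1 / (q - inverse q)) (act M K v - act M Kinv v)"
    and E_E: "act M E (act M E v) = 0"
    and F_F: "act M F (act M F v) = 0"
    and Sig_E: "act M Sig (act M E v) = - act M E (act M Sig v)"
    and Sig_F: "act M Sig (act M F v) = - act M F (act M Sig v)"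
    and Sig_Q: "act M Sig (act M (Q h) v) = act M (Q h) (act M Sig v)"
    and Sig_Sig: "act M Sig (act M Sig v) = v"
  using is_module assms unfolding Uq_module_def by blast+

lemma submodule:
  assumes "W \<subseteq> uspace M" "subspace W" "\<And>g v. v \<in> W \<Longrightarrow> act M g v \<in> W"
  shows "Uq_module q s (M\<lparr>uspace := W\<rparr>)"
  using is_module assms unfolding Uq_module_def by (auto simp: subset_iff)

text \<open>
  The elements \<open>h\<close> of the lattice for which \<open>Q h\<close> acts on \<open>w\<close> by the expected scalar form a
  subgroup; it contains the two basis vectors.
\<close>

lemma Q_highest_weight_vector:
  assumes w: "highest_weight_vector q s m n M w" and "q \<noteq> 0"
  shows "act M (Q h) w = s (q powi pairing h (m, n)) w"
proof -
  define P where "P h \<longleftrightarrow> act M (Q h) w = s (q powi pairing h (m, n)) w" for h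
  have wU: "w \<in> uspace M" using w by (simp add: highest_weight_vector_def)
  have add: "P (h + h')" if "P h" "P h'" for h h'
  proof -
    have "act M (Q (h + h')) w = act M (Q h) (act M (Q h') w)"
      by (simp add: Q_Q wU)
    also have "\<dots> = s (q powi pairing h' (m, n) * q powi pairing h (m, n)) w"
      using that wU by (simp add: P_def act_scale)
    also have "q powi pairing h' (m, n) * q powi pairing h (m, n) = q powi pairing (h + h') (m, n)"
      using \<open>q \<noteq> 0\<close> by (simp add: pairing_def algebra_simps flip: power_int_add)
    finally show ?thesis by (simp add: P_def)
  qed
  have zero: "P 0" by (simp add: P_def Q_0 wU pairing_def)
  have neg: "P (- h)" if "P h" for h
  proof -
    have "w = act M (Q (- h)) (act M (Q h) w)"
      using wU by (simp add: Q_Q Q_0)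
    also have "\<dots> = s (q powi pairing h (m, n)) (act M (Q (- h)) w)"
      using that wU by (simp add: P_def act_scale)
    finally have "s (q powi pairing (- h) (m, n)) w
        = s (q powi pairing (- h) (m, n) * q powi pairing h (m, n)) (act M (Q (- h)) w)"
      by (metis scale_scale)
    also have "q powi pairing (- h) (m, n) * q powi pairing h (m, n) = 1"
      using \<open>q \<noteq> 0\<close> by (simp add: pairing_def flip: power_int_add)
    finally show ?thesis by (simp add: P_def)
  qed
  have mult: "P (i * a, i * b)" if "P (a, b)" for i a b :: int
  proof (induction i rule: int_induct[where k = 0])
    case (step1 i)
    show ?case using add[OF that step1(2)] by (simp add: algebra_simps)
  next
    case (step2 i)
    show ?case using add[OF step2(2) neg[OF that]] by (simp add: algebra_simps)
  qed (use zero in \<open>simp add: zero_prod_def\<close>)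
  have "P (1, 0)" "P (0, 1)"
    using w by (auto simp: P_def highest_weight_vector_def h1_def h2_def pairing_def)
  then have "P (fst h * 1, fst h * 0)" "P (snd h * 0, snd h * 1)"
    by (blast intro: mult)+
  from add[OF this] show ?thesis by (simp add: P_def)
qed

lemma E_F_highest_weight_vector:
  assumes w: "highest_weight_vector q s m n M w" and "q \<noteq> 0"
  shows "act M E (act M F w) = s (q_number q (m + n)) w"
proof -
  have wU: "w \<in> uspace M" and Ew: "act M E w = 0"
    using w by (auto simp: highest_weight_vector_def)
  have "act M E (act M F w) = act M E (act M F w) + act M F (act M E w)"
    by (simp add: Ew act_zero)
  also have "\<dots> = s (1 / (q - inverse q)) (s (q powi (m + n)) w - s (q powi (- (m + n))) w)"
    using Q_highest_weight_vector[OF w \<open>q \<noteq> 0\<close>]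
    by (simp add: EF_FE wU pairing_def h1_def h2_def)
  also have "\<dots> = s (q_number q (m + n)) w"
    by (simp add: q_number_def scale_left_diff_distrib[symmetric])
  finally show ?thesis .
qed

lemma weight_comb_closed: "w \<in> uspace M \<Longrightarrow> weight_comb s M w p \<in> uspace M"
  unfolding weight_comb_def
  by (intro subspace_add[OF sub_uspace] subspace_scale[OF sub_uspace] act_closed)

lemma act_weight_comb:
  assumes w: "highest_weight_vector q s m n M w" and "q \<noteq> 0"
  shows "act M g (weight_comb s M w p) = weight_comb s M w (std_act q m n g p)"
proof -
  have wU: "w \<in> uspace M" and Ew: "act M E w = 0" and Sw: "act M Sig w = s ((-1) powi n) w"
    using w by (auto simp: highest_weight_vector_def)
  have FU: "act M F w \<in> uspace M" by (simp add: act_closed wU)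
  have "act M g (weight_comb s M w p) = s (fst p) (act M g w) + s (snd p) (act M g (act M F w))"
    using wU FU by (simp add: weight_comb_def act_add act_scale subspace_scale[OF sub_uspace])
  also have "\<dots> = weight_comb s M w (std_act q m n g p)"
  proof (cases g)
    case E
    then show ?thesis
      by (simp add: weight_comb_def Ew E_F_highest_weight_vector[OF assms])
  next
    case F
    then show ?thesis by (simp add: weight_comb_def F_F wU)
  next
    case Sig
    then show ?thesis by (simp add: weight_comb_def Sw Sig_F wU act_scale)
  next
    case (Q h)
    have "pairing h (m, n) - pairing h alpha = pairing h (m - 1, n + 1)"
      by (simp add: pairing_def alpha_def eps1_def eps2_def algebra_simps)
    then have "q powi (- pairing h alpha) * q powi pairing h (m, n)
        = q powi pairing h (m - 1, n + 1)"
      using \<open>q \<noteq> 0\<close> by (simp flip: power_int_add)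
    then have "act M (Q h) (act M F w) = s (q powi pairing h (m - 1, n + 1)) (act M F w)"
      using wU by (simp add: Q_F Q_highest_weight_vector[OF assms] act_scale)
    then show ?thesis
      by (simp add: Q weight_comb_def Q_highest_weight_vector[OF assms])
  qed
  finally show ?thesis .
qed

lemma weight_comb_add: "weight_comb s M w (p + p') = weight_comb s M w p + weight_comb s M w p'"
  by (simp add: weight_comb_def scale_left_distrib algebra_simps)

lemma weight_comb_scale: "s c (weight_comb s M w p) = weight_comb s M w (c * fst p, c * snd p)"
  by (simp add: weight_comb_def scale_right_distrib)

lemma range_weight_comb: "range (weight_comb s M w) = span {w, act M F w}"
proof
  show "range (weight_comb s M w) \<subseteq> span {w, act M F w}"
    unfolding weight_comb_def by (intro image_subsetI span_add span_scale span_base) auto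
  have "subspace (range (weight_comb s M w))"
  proof (rule subspaceI)
    show "0 \<in> range (weight_comb s M w)"
      by (rule range_eqI[of _ _ 0]) (simp add: weight_comb_def)
  qed (use weight_comb_add[symmetric] in \<open>auto simp: weight_comb_scale\<close>)
  moreover have "w = weight_comb s M w (1, 0)" "act M F w = weight_comb s M w (0, 1)"
    by (simp_all add: weight_comb_def)
  then have "{w, act M F w} \<subseteq> range (weight_comb s M w)"
    by (metis empty_subsetI insert_subset rangeI)
  ultimately show "span {w, act M F w} \<subseteq> range (weight_comb s M w)"
    by (simp add: span_minimal)
qed

text \<open>
  Applying \<open>E\<close> to a linear relation between \<open>w\<close> and \<open>F w\<close> isolates the coefficient of \<open>F w\<close>.
\<close>

lemma weight_comb_eq_0D:
  assumes w: "highest_weight_vector q s m n M w" and "q \<noteq> 0" "q_number q (m + n) \<noteq> 0"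
    and "weight_comb s M w p = 0"
  shows "p = 0"
proof -
  have "w \<noteq> 0" using w by (simp add: highest_weight_vector_def)
  have "weight_comb s M w (std_act q m n E p) = act M E (weight_comb s M w p)"
    by (simp only: act_weight_comb[OF assms(1,2)])
  then have "snd p = 0"
    using assms \<open>w \<noteq> 0\<close> by (simp add: weight_comb_def act_zero)
  with assms(4) \<open>w \<noteq> 0\<close> have "fst p = 0" by (simp add: weight_comb_def)
  with \<open>snd p = 0\<close> show ?thesis by (simp add: prod_eq_iff)
qed

lemma inj_weight_comb:
  assumes "highest_weight_vector q s m n M w" "q \<noteq> 0" "q_number q (m + n) \<noteq> 0"
  shows "inj (weight_comb s M w)"
proof (rule injI)
  fix p p' assume "weight_comb s M w p = weight_comb s M w p'"
  moreover have "weight_comb s M w (p - p') + weight_comb s M w p' = weight_comb s M w p"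
    by (simp flip: weight_comb_add)
  ultimately have "weight_comb s M w (p - p') = 0" by simp
  from weight_comb_eq_0D[OF assms this] show "p = p'" by simp
qed

text \<open>
  The heart of irreducibility.  A nonzero combination \<open>v\<close> of \<open>w\<close> and \<open>F w\<close> recovers \<open>w\<close>: either
  \<open>v\<close> is already a multiple of \<open>w\<close>, or \<open>E v\<close> is a nonzero one.
\<close>

lemma range_weight_comb_minimal:
  assumes w: "highest_weight_vector q s m n M w" and "q \<noteq> 0" "q_number q (m + n) \<noteq> 0"
    and W: "subspace W" "\<And>g v. v \<in> W \<Longrightarrow> act M g v \<in> W"
    and p: "weight_comb s M w p \<in> W" "weight_comb s M w p \<noteq> 0"
  shows "range (weight_comb s M w) \<subseteq> W"
proof -
  have "w \<in> W"
  proof (cases "snd p = 0")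
    case True
    with p have "fst p \<noteq> 0" and "s (fst p) w \<in> W" by (auto simp: weight_comb_def)
    then show ?thesis using subspace_scale[OF W(1), of "s (fst p) w" "inverse (fst p)"] by simp
  next
    case False
    have "weight_comb s M w (std_act q m n E p) \<in> W"
      using W(2)[OF p(1), of E] by (simp only: act_weight_comb[OF assms(1,2)])
    then have "s (snd p * q_number q (m + n)) w \<in> W"
      by (simp add: weight_comb_def)
    moreover define c where "c = snd p * q_number q (m + n)"
    ultimately have "s (inverse c) (s c w) \<in> W" by (simp only: subspace_scale[OF W(1)])
    moreover have "c \<noteq> 0" using False assms(3) by (simp add: c_def)
    ultimately show ?thesis by simp
  qed
  then show ?thesis
    using W by (auto simp: weight_comb_def intro!: subspace_add subspace_scale)
qed

lemma span_highest_weight_vector: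
  assumes w: "highest_weight_vector q s m n M w" and "q \<noteq> 0" "q_number q (m + n) \<noteq> 0"
  shows "is_Lq q s m n (M\<lparr>uspace := span {w, act M F w}\<rparr>)" (is "is_Lq q s m n ?N")
proof -
  have wU: "w \<in> uspace M" and "w \<noteq> 0" using w by (auto simp: highest_weight_vector_def)
  have "Uq_irreducible q s ?N"
    unfolding Uq_irreducible_def
  proof (intro conjI allI impI; (elim conjE)?)
    show "Uq_module q s ?N"
    proof (rule submodule)
      show "span {w, act M F w} \<subseteq> uspace M"
        using weight_comb_closed[OF wU] by (auto simp flip: range_weight_comb)
      fix g v assume "v \<in> span {w, act M F w}"
      then obtain p where "v = weight_comb s M w p" by (auto simp flip: range_weight_comb)
      then show "act M g v \<in> span {w, act M F w}"
        using act_weight_comb[OF assms(1,2)] by (auto simp flip: range_weight_comb)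
    qed (rule subspace_span)
    show "uspace ?N \<noteq> {0}" using \<open>w \<noteq> 0\<close> span_base[of w "{w, act M F w}"] by auto
    fix W assume W: "W \<subseteq> uspace ?N" "subspace W" "\<forall>g. \<forall>v\<in>W. act ?N g v \<in> W"
    show "W = {0} \<or> W = uspace ?N"
    proof (cases "W = {0}")
      case False
      with subspace_0[OF W(2)] obtain v where "v \<in> W" "v \<noteq> 0" by blast
      moreover from this W(1) obtain p where "v = weight_comb s M w p"
        by (auto simp flip: range_weight_comb)
      ultimately show ?thesis
        using range_weight_comb_minimal[OF assms W(2)] W by (auto simp: range_weight_comb)
    qed simp
  qed
  moreover have "\<exists>B. finite B \<and> B \<subseteq> uspace ?N \<and> span B = uspace ?N"
    by (rule exI[of _ "{w, act M F w}"]) (simp add: span_superset)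
  moreover have "w \<in> uspace ?N" by (simp add: span_base)
  ultimately show ?thesis
    using w unfolding is_Lq_def highest_weight_vector_def by auto
qed

end

text \<open>
  Irreducibility forces the submodule spanned by \<open>w\<close> and \<open>F w\<close> to be the whole module.
\<close>

lemma Lq_coordinates:
  assumes L: "is_Lq q s m n M" and "q \<noteq> 0" "q_number q (m + n) \<noteq> 0"
  obtains w where "highest_weight_vector q s m n M w" "bij_betw (weight_comb s M w) UNIV (uspace M)"
proof -
  from L have irr: "Uq_irreducible q s M" by (simp add: is_Lq_def)
  then have mod: "Uq_module q s M" by (simp add: Uq_irreducible_def)
  interpret vector_space s using mod by (simp add: Uq_module_def)
  interpret quantum_module s q M by unfold_locales (rule mod)
  from L obtain w where w: "highest_weight_vector q s m n M w"
    by (auto simp: is_Lq_def highest_weight_vector_def)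
  then have wU: "w \<in> uspace M" and "w \<noteq> 0" by (auto simp: highest_weight_vector_def)
  have "span {w, act M F w} \<noteq> {0}"
    using \<open>w \<noteq> 0\<close> span_base[of w "{w, act M F w}"] by auto
  moreover have "span {w, act M F w} \<subseteq> uspace M"
    using weight_comb_closed[OF wU] by (auto simp flip: range_weight_comb)
  moreover have "act M g v \<in> span {w, act M F w}" if "v \<in> span {w, act M F w}" for g v
    using that act_weight_comb[OF w assms(2)] by (auto simp flip: range_weight_comb)
  ultimately have "span {w, act M F w} = uspace M"
    using irr subspace_span unfolding Uq_irreducible_def by blast
  then show thesis
    using that[OF w] inj_weight_comb[OF w assms(2,3)]
    by (simp add: bij_betw_def range_weight_comb)
qed

lemma Lq_unique:
  assumes M: "is_Lq q s m n M" and N: "is_Lq q t m n N"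
    and "q \<noteq> 0" "q_number q (m + n) \<noteq> 0"
  shows "Uq_isomorphic q s M t N"
proof -
  have mod: "Uq_module q s M" "Uq_module q t N"
    using M N by (auto simp: is_Lq_def Uq_irreducible_def)
  interpret M: vector_space s using mod by (simp add: Uq_module_def)
  interpret N: vector_space t using mod by (simp add: Uq_module_def)
  interpret M: quantum_module s q M by unfold_locales (rule mod)
  interpret N: quantum_module t q N by unfold_locales (rule mod)
  obtain w where w: "highest_weight_vector q s m n M w"
      and bij: "bij_betw (weight_comb s M w) UNIV (uspace M)"
    using Lq_coordinates[OF M assms(3,4)] .
  obtain w' where w': "highest_weight_vector q t m n N w'"
      and bij': "bij_betw (weight_comb t N w') UNIV (uspace N)"
    using Lq_coordinates[OF N assms(3,4)] .
  define \<phi> where "\<phi> = weight_comb t N w' \<circ> inv (weight_comb s M w)"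
  have \<phi>: "\<phi> (weight_comb s M w p) = weight_comb t N w' p" for p
    using bij by (simp add: \<phi>_def bij_betw_def)
  have U: "\<exists>p. v = weight_comb s M w p" if "v \<in> uspace M" for v
    using bij that unfolding bij_betw_def by (metis imageE)
  have "bij_betw \<phi> (uspace M) (uspace N)"
    unfolding \<phi>_def using bij bij' bij_betw_inv_into bij_betw_trans by blast
  moreover have "\<phi> (v + v') = \<phi> v + \<phi> v'" if v: "v \<in> uspace M" "v' \<in> uspace M" for v v'
  proof -
    obtain p p' where p: "v = weight_comb s M w p" "v' = weight_comb s M w p'"
      using U[OF v(1)] U[OF v(2)] by blast
    then have "v + v' = weight_comb s M w (p + p')" by (simp only: M.weight_comb_add)
    with p show ?thesis by (simp only: \<phi> N.weight_comb_add)
  qed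
  moreover have "\<phi> (s c v) = t c (\<phi> v)" if "v \<in> uspace M" for c v
    using U[OF that] \<phi> by (auto simp: M.weight_comb_scale N.weight_comb_scale)
  moreover have "\<phi> (act M g v) = act N g (\<phi> v)" if v: "v \<in> uspace M" for g v
  proof -
    obtain p where p: "v = weight_comb s M w p" using U[OF v] by blast
    show ?thesis
      by (simp only: p \<phi> M.act_weight_comb[OF w assms(3)] N.act_weight_comb[OF w' assms(3)])
  qed
  ultimately show ?thesis
    using mod unfolding Uq_isomorphic_def by blast
qed

section \<open>Direct sums\<close>

lemma Uq_module_external_direct_sum:
  assumes s: "vector_space s" and N: "\<And>j. j \<in> J \<Longrightarrow> Uq_module q s (N j)"
  shows "Uq_module q (external_scale s) (external_direct_sum J N)"
proof -
  interpret vector_space s by (rule s)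
  have vs: "vector_space (external_scale s :: _ \<Rightarrow> ('b \<Rightarrow> 'a) \<Rightarrow> _)"
    by unfold_locales (simp_all add: external_scale_def fun_eq_iff algebra_simps)
  interpret ext: vector_space "external_scale s :: _ \<Rightarrow> ('b \<Rightarrow> 'a) \<Rightarrow> _" by (rule vs)
  have Nj: "quantum_module s q (N j)" if "j \<in> J" for j
    using N[OF that] by unfold_locales
  note [simp] = quantum_module.act_add[OF Nj] quantum_module.act_scale[OF Nj]
    quantum_module.act_zero[OF Nj] quantum_module.Q_0[OF Nj] quantum_module.Q_Q[OF Nj]
    quantum_module.EF_FE[OF Nj] quantum_module.E_E[OF Nj] quantum_module.F_F[OF Nj]
    quantum_module.Sig_E[OF Nj] quantum_module.Sig_F[OF Nj] quantum_module.Sig_Q[OF Nj]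
    quantum_module.Sig_Sig[OF Nj]
  let ?N = "external_direct_sum J N"
  have "ext.subspace (uspace ?N)"
  proof (rule ext.subspaceI)
    fix f g assume "f \<in> uspace ?N" "g \<in> uspace ?N"
    moreover have "{i. (f + g) i \<noteq> 0} \<subseteq> {i. f i \<noteq> 0} \<union> {i. g i \<noteq> 0}" by auto
    ultimately show "f + g \<in> uspace ?N"
      using quantum_module.sub_uspace[OF Nj]
      by (auto simp: external_direct_sum_def subspace_add intro: finite_subset)
  next
    fix c f assume "f \<in> uspace ?N"
    moreover have "{i. external_scale s c f i \<noteq> 0} \<subseteq> {i. f i \<noteq> 0}"
      by (auto simp: external_scale_def)
    ultimately show "external_scale s c f \<in> uspace ?N"
      using quantum_module.sub_uspace[OF Nj]
      by (auto simp: external_direct_sum_def external_scale_def subspace_scale intro: finite_subset)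
  qed (use quantum_module.sub_uspace[OF Nj] in \<open>auto simp: external_direct_sum_def subspace_0\<close>)
  moreover have "act ?N g f \<in> uspace ?N" if "f \<in> uspace ?N" for g f
  proof -
    have "{i. act ?N g f i \<noteq> 0} \<subseteq> {i. f i \<noteq> 0}"
      by (auto simp: external_direct_sum_def split: if_splits)
    moreover have "finite {i. f i \<noteq> 0}" using that by (simp add: external_direct_sum_def)
    ultimately have "finite {i. act ?N g f i \<noteq> 0}" by (rule finite_subset)
    with that show ?thesis
      using quantum_module.act_closed[OF Nj] by (simp add: external_direct_sum_def)
  qed
  ultimately show ?thesis
    unfolding Uq_module_def
    by (intro conjI allI ballI vs; (assumption | simp add: external_direct_sum_def external_scale_def
        fun_eq_iff quantum_module.Q_E[OF Nj] quantum_module.Q_F[OF Nj]))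
qed

lemma internal_direct_sum_reindex:
  fixes T :: "'v::comm_monoid_add set"
  assumes b: "bij_betw b J I" and T: "internal_direct_sum T I A"
  shows "internal_direct_sum T J (A \<circ> b)"
proof -
  let ?r = "\<lambda>w. restrict (w \<circ> b) J"
  have "bij_betw ?r (Pi\<^sub>E I A) (Pi\<^sub>E J (A \<circ> b))"
  proof (rule bij_betwI[where g = "\<lambda>w. restrict (w \<circ> inv_into J b) I"])
    show "?r \<in> Pi\<^sub>E I A \<rightarrow> Pi\<^sub>E J (A \<circ> b)"
      using b by (auto simp: bij_betw_def)
    show "(\<lambda>w. restrict (w \<circ> inv_into J b) I) \<in> Pi\<^sub>E J (A \<circ> b) \<rightarrow> Pi\<^sub>E I A"
      using b bij_betw_inv_into_right[OF b] by (fastforce simp: bij_betw_def inv_into_into)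
  qed (use b in \<open>auto simp: fun_eq_iff bij_betw_def restrict_def PiE_def extensional_def inv_into_into\<close>)
  moreover have "bij_betw ((\<lambda>w. \<Sum>j\<in>J. w j) \<circ> ?r) (Pi\<^sub>E I A) T"
  proof -
    have "(\<lambda>w. \<Sum>j\<in>J. w j) \<circ> ?r = (\<lambda>w. \<Sum>i\<in>I. (w i :: 'v))"
      by (rule ext) (simp add: sum.reindex_bij_betw[OF b])
    with T show ?thesis
      unfolding internal_direct_sum_def by (simp only:)
  qed
  ultimately show ?thesis
    unfolding internal_direct_sum_def by (simp add: bij_betw_comp_iff)
qed

text \<open>
  The usual criterion: spanning and independence.  It speaks of arbitrary functions on \<open>I\<close> instead
  of extensional ones, so that families need not be restricted when it is applied.
\<close>

lemma internal_direct_sumI: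
  assumes "vector_space s" and A: "\<And>i. i \<in> I \<Longrightarrow> module.subspace s (A i)"
    and sum: "\<And>w. w \<in> Pi I A \<Longrightarrow> (\<Sum>i\<in>I. w i) \<in> T"
    and indep: "\<And>w. w \<in> Pi I A \<Longrightarrow> (\<Sum>i\<in>I. w i) = 0 \<Longrightarrow> \<forall>i\<in>I. w i = 0"
    and gen: "\<And>v. v \<in> T \<Longrightarrow> \<exists>w\<in>Pi I A. v = (\<Sum>i\<in>I. w i)"
  shows "internal_direct_sum T I A"
  unfolding internal_direct_sum_def
proof (rule bij_betw_imageI)
  interpret vector_space s by fact
  show "inj_on (\<lambda>w. \<Sum>i\<in>I. w i) (Pi\<^sub>E I A)"
  proof (rule inj_onI)
    fix w w' assume w: "w \<in> Pi\<^sub>E I A" "w' \<in> Pi\<^sub>E I A" "(\<Sum>i\<in>I. w i) = (\<Sum>i\<in>I. w' i)"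
    then have "(\<lambda>i. w i - w' i) \<in> Pi I A" using subspace_diff[OF A] by (auto simp: PiE_def Pi_def)
    moreover have "(\<Sum>i\<in>I. w i - w' i) = 0" using w by (simp add: sum_subtractf)
    ultimately have "\<forall>i\<in>I. w i - w' i = 0" by (rule indep)
    with w show "w = w'" by (intro PiE_ext) auto
  qed
  show "(\<lambda>w. \<Sum>i\<in>I. w i) ` Pi\<^sub>E I A = T"
  proof (intro equalityI subsetI)
    fix v assume "v \<in> T"
    then obtain w where "w \<in> Pi I A" "v = (\<Sum>i\<in>I. w i)" using gen by blast
    then show "v \<in> (\<lambda>w. \<Sum>i\<in>I. w i) ` Pi\<^sub>E I A"
      by (intro image_eqI[of _ _ "restrict w I"]) auto
  qed (use sum in auto)
qed

text \<open>
  Decompose a vector into its components and send each component through its own isomorphism.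
  Since the components are unique, the decomposition commutes with the action.
\<close>

lemma isomorphic_external_direct_sum:
  fixes T :: "'v::ab_group_add Uq_mod" and J :: "'j set" and N :: "'j \<Rightarrow> 'w::ab_group_add Uq_mod"
  assumes T: "Uq_module q t T" and s: "vector_space s" and "finite J"
    and sum: "internal_direct_sum (uspace T) J A"
    and sub: "\<And>j. j \<in> J \<Longrightarrow> A j \<subseteq> uspace T"
    and iso: "\<And>j. j \<in> J \<Longrightarrow> Uq_isomorphic q t (T\<lparr>uspace := A j\<rparr>) s (N j)"
  shows "Uq_isomorphic q t T (external_scale s) (external_direct_sum J N)"
proof -
  interpret t: vector_space t using T by (simp add: Uq_module_def)
  interpret T: quantum_module t q T by unfold_locales (rule T)
  have A: "Uq_module q t (T\<lparr>uspace := A j\<rparr>)" "Uq_module q s (N j)" if "j \<in> J" for j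
    using iso[OF that] by (auto simp: Uq_isomorphic_def)
  have ext: "Uq_module q (external_scale s) (external_direct_sum J N)"
    using s A by (intro Uq_module_external_direct_sum)
  have A_closed: "t.subspace (A j)" "v \<in> A j \<Longrightarrow> act T g v \<in> A j" if "j \<in> J" for j g v
    using A(1)[OF that] by (auto simp: Uq_module_def)
  obtain \<psi> where \<psi>_iso: "\<forall>j\<in>J. bij_betw (\<psi> j) (A j) (uspace (N j)) \<and>
        (\<forall>v\<in>A j. \<forall>w\<in>A j. \<psi> j (v + w) = \<psi> j v + \<psi> j w) \<and>
        (\<forall>c. \<forall>v\<in>A j. \<psi> j (t c v) = s c (\<psi> j v)) \<and>
        (\<forall>g. \<forall>v\<in>A j. \<psi> j (act T g v) = act (N j) g (\<psi> j v))"
  proof (rule exE[OF bchoice])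
    show "\<forall>j\<in>J. \<exists>\<psi>. bij_betw \<psi> (A j) (uspace (N j)) \<and>
        (\<forall>v\<in>A j. \<forall>w\<in>A j. \<psi> (v + w) = \<psi> v + \<psi> w) \<and>
        (\<forall>c. \<forall>v\<in>A j. \<psi> (t c v) = s c (\<psi> v)) \<and>
        (\<forall>g. \<forall>v\<in>A j. \<psi> (act T g v) = act (N j) g (\<psi> v))"
      using iso unfolding Uq_isomorphic_def by simp
  qed blast
  have bij: "\<And>j. j \<in> J \<Longrightarrow> bij_betw (\<psi> j) (A j) (uspace (N j))"
    and \<psi>: "\<And>j v w. j \<in> J \<Longrightarrow> v \<in> A j \<Longrightarrow> w \<in> A j \<Longrightarrow> \<psi> j (v + w) = \<psi> j v + \<psi> j w"
      "\<And>j c v. j \<in> J \<Longrightarrow> v \<in> A j \<Longrightarrow> \<psi> j (t c v) = s c (\<psi> j v)"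
      "\<And>j g v. j \<in> J \<Longrightarrow> v \<in> A j \<Longrightarrow> \<psi> j (act T g v) = act (N j) g (\<psi> j v)"
    using \<psi>_iso by blast+
  define S :: "('j \<Rightarrow> 'v) \<Rightarrow> 'v" where "S w = (\<Sum>j\<in>J. w j)" for w
  define \<Psi> where "\<Psi> w = (\<lambda>j. if j \<in> J then \<psi> j (w j) else 0)" for w
  define \<phi> where "\<phi> = \<Psi> \<circ> inv_into (Pi\<^sub>E J A) S"
  have S: "bij_betw S (Pi\<^sub>E J A) (uspace T)"
    using sum by (simp add: internal_direct_sum_def S_def[abs_def])
  have "bij_betw \<Psi> (Pi\<^sub>E J A) (uspace (external_direct_sum J N))"
  proof (rule bij_betwI[where g = "\<lambda>f. \<lambda>j\<in>J. inv_into (A j) (\<psi> j) (f j)"])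
    have "{i. \<Psi> w i \<noteq> 0} \<subseteq> J" for w by (auto simp: \<Psi>_def)
    then show "\<Psi> \<in> Pi\<^sub>E J A \<rightarrow> uspace (external_direct_sum J N)"
      using bij finite_subset[OF _ \<open>finite J\<close>]
      by (fastforce simp: external_direct_sum_def \<Psi>_def bij_betw_def)
    show "(\<lambda>f. \<lambda>j\<in>J. inv_into (A j) (\<psi> j) (f j)) \<in> uspace (external_direct_sum J N) \<rightarrow> Pi\<^sub>E J A"
      using bij by (auto simp: external_direct_sum_def bij_betw_def intro!: inv_into_into)
  next
    fix w assume "w \<in> Pi\<^sub>E J A"
    then show "(\<lambda>j\<in>J. inv_into (A j) (\<psi> j) (\<Psi> w j)) = w"
      using bij by (auto simp: \<Psi>_def fun_eq_iff bij_betw_def PiE_def Pi_def extensional_def)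
  next
    fix f assume "f \<in> uspace (external_direct_sum J N)"
    then show "\<Psi> (\<lambda>j\<in>J. inv_into (A j) (\<psi> j) (f j)) = f"
      using bij by (auto simp: \<Psi>_def fun_eq_iff bij_betw_def external_direct_sum_def f_inv_into_f)
  qed
  then have "bij_betw \<phi> (uspace T) (uspace (external_direct_sum J N))"
    unfolding \<phi>_def using S bij_betw_inv_into bij_betw_trans by blast
  moreover have \<phi>: "\<phi> (S w) = \<Psi> w" if "w \<in> Pi\<^sub>E J A" for w
    using S that by (simp add: \<phi>_def bij_betw_def)
  have U: "\<exists>w. w \<in> Pi\<^sub>E J A \<and> v = S w" if "v \<in> uspace T" for v
    using S that unfolding bij_betw_def by (metis imageE)
  have "\<phi> (v + v') = \<phi> v + \<phi> v'" if v: "v \<in> uspace T" "v' \<in> uspace T" for v v'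
  proof -
    obtain w w' where w: "w \<in> Pi\<^sub>E J A" "v = S w" and w': "w' \<in> Pi\<^sub>E J A" "v' = S w'"
      using U[OF v(1)] U[OF v(2)] by blast
    let ?w = "\<lambda>j\<in>J. w j + w' j"
    have "?w \<in> Pi\<^sub>E J A"
      using w w' A_closed(1) t.subspace_add by (auto simp: PiE_def Pi_def)
    moreover have "v + v' = S ?w" by (simp add: w w' S_def sum.distrib)
    moreover have "\<Psi> ?w = \<Psi> w + \<Psi> w'"
      using w w' \<psi>(1) by (auto simp: \<Psi>_def fun_eq_iff PiE_def Pi_def)
    ultimately show ?thesis using w w' by (simp add: \<phi>)
  qed
  moreover have "\<phi> (t c v) = external_scale s c (\<phi> v)" if v: "v \<in> uspace T" for c v
  proof -
    interpret s: vector_space s by (rule s)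
    obtain w where w: "w \<in> Pi\<^sub>E J A" "v = S w" using U[OF v] by blast
    let ?w = "\<lambda>j\<in>J. t c (w j)"
    have "?w \<in> Pi\<^sub>E J A"
      using w A_closed(1) t.subspace_scale by (auto simp: PiE_def Pi_def)
    moreover have "t c v = S ?w" by (simp add: w S_def t.scale_sum_right)
    moreover have "\<Psi> ?w = external_scale s c (\<Psi> w)"
      using w \<psi>(2) by (auto simp: \<Psi>_def fun_eq_iff PiE_def Pi_def external_scale_def)
    ultimately show ?thesis using w by (simp add: \<phi>)
  qed
  moreover have "\<phi> (act T g v) = act (external_direct_sum J N) g (\<phi> v)" if v: "v \<in> uspace T" for g v
  proof -
    obtain w where w: "w \<in> Pi\<^sub>E J A" "v = S w" using U[OF v] by blast
    let ?w = "\<lambda>j\<in>J. act T g (w j)"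
    have "?w \<in> Pi\<^sub>E J A"
      using w A_closed(2) by (auto simp: PiE_def Pi_def)
    moreover have "act T g v = S ?w"
      using w sub by (simp add: S_def) (subst T.act_sum, auto simp: PiE_def Pi_def)
    moreover have "\<Psi> ?w = act (external_direct_sum J N) g (\<Psi> w)"
      using w \<psi>(3) by (auto simp: \<Psi>_def fun_eq_iff PiE_def Pi_def external_direct_sum_def)
    ultimately show ?thesis using w by (simp add: \<phi>)
  qed
  ultimately show ?thesis
    using T ext unfolding Uq_isomorphic_def by blast
qed

section \<open>Tensoring with the natural module\<close>

text \<open>
  Every element of \<open>V \<otimes> N\<close> is \<open>x \<otimes> a + y \<otimes> b\<close> for unique \<open>a\<close> and \<open>b\<close> in \<open>N\<close>.  All computations
  below are done on the two components.
\<close>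

abbreviation xy :: "(letter list \<Rightarrow> complex) \<Rightarrow> (letter list \<Rightarrow> complex) \<Rightarrow> letter list \<Rightarrow> complex" where
  "xy a b \<equiv> tens xvec a + tens yvec b"

lemma word_split_cases [case_names Nil X Y]:
  "\<lbrakk>w = [] \<Longrightarrow> P; \<And>u. w = LX # u \<Longrightarrow> P; \<And>u. w = LY # u \<Longrightarrow> P\<rbrakk> \<Longrightarrow> P"
  by (metis letter.exhaust list.exhaust)

lemma xy_apply [simp]: "xy a b [] = 0" "xy a b (LX # u) = a u" "xy a b (LY # u) = b u"
  by (simp_all add: tens_def xvec_def yvec_def)

lemma xy_cong: "(\<And>u. f (LX # u) = a u) \<Longrightarrow> (\<And>u. f (LY # u) = b u) \<Longrightarrow> f [] = 0 \<Longrightarrow> f = xy a b"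
  by (rule ext, case_tac x rule: word_split_cases) (simp_all del: plus_fun_apply)

lemma vector_space_fscale: "vector_space fscale"
  by unfold_locales (simp_all add: fscale_def fun_eq_iff algebra_simps)

interpretation fscale: vector_space fscale by (rule vector_space_fscale)

context
  fixes q :: complex and N :: "(letter list \<Rightarrow> complex) Uq_mod"
begin

abbreviation VN :: "(letter list \<Rightarrow> complex) Uq_mod" where
  "VN \<equiv> tens_module (natural_module q) N"

lemmas tensor_act_defs = tens_module_def word_act_def tens_op_def natural_module_def
  fscale_def xvec_def yvec_def pairing_def eps1_def eps2_def h1_def h2_def

text \<open>
  The coproduct on the two components.  The operators \<open>K\<close> and \<open>Sig\<close> of the first tensor
  factor contribute the scalars \<open>q\<close> and \<open>1\<close> or \<open>- 1\<close>.
\<close>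

lemma act_tensor_E:
  "act VN E f = xy (act N Kinv (\<lambda>u. f (LY # u)) + act N E (\<lambda>u. f (LX # u)))
                  (- act N E (\<lambda>u. f (LY # u)))"
  by (rule xy_cong) (simp_all add: tensor_act_defs)

lemma act_tensor_F:
  "act VN F f = xy (fscale q (act N F (\<lambda>u. f (LX # u))))
                  ((\<lambda>u. f (LX # u)) - fscale q (act N F (\<lambda>u. f (LY # u))))"
  by (rule xy_cong) (simp_all add: tensor_act_defs)

lemma act_tensor_Sig:
  "act VN Sig f = xy (act N Sig (\<lambda>u. f (LX # u))) (- act N Sig (\<lambda>u. f (LY # u)))"
  by (rule xy_cong) (simp_all add: tensor_act_defs)

lemma act_tensor_Q:
  "act VN (Q h) f = xy (fscale (q powi fst h) (act N (Q h) (\<lambda>u. f (LX # u))))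
                      (fscale (q powi snd h) (act N (Q h) (\<lambda>u. f (LY # u))))"
  by (rule xy_cong) (simp_all add: tensor_act_defs)

lemmas act_tensor = act_tensor_E act_tensor_F act_tensor_Sig act_tensor_Q

lemma uspace_tensor:
  assumes N: "fscale.subspace (uspace N)"
  shows "uspace VN = {f. f [] = 0 \<and> (\<lambda>u. f (LX # u)) \<in> uspace N \<and> (\<lambda>u. f (LY # u)) \<in> uspace N}"
    (is "_ = ?S")
proof -
  have "uspace VN = fscale.span {tens v f |v f. f \<in> uspace N}"
    by (simp add: tens_module_def natural_module_def)
  also have "\<dots> = ?S"
  proof (rule fscale.span_unique)
    show "{tens v f |v f. f \<in> uspace N} \<subseteq> ?S"
      using fscale.subspace_scale[OF N] by (auto simp: tens_def fscale_def)
    have "(0::letter list \<Rightarrow> complex) \<in> uspace N" by (rule fscale.subspace_0[OF N])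
    then show "fscale.subspace ?S"
      using fscale.subspace_add[OF N] fscale.subspace_scale[OF N]
      by (intro fscale.subspaceI) (auto simp: fscale_def plus_fun_def zero_fun_def)
    fix T assume T: "{tens v f |v f. f \<in> uspace N} \<subseteq> T" "fscale.subspace T"
    show "?S \<subseteq> T"
    proof
      fix f assume f: "f \<in> ?S"
      then have "f = xy (\<lambda>u. f (LX # u)) (\<lambda>u. f (LY # u))"
        by (intro xy_cong) simp_all
      moreover have "xy (\<lambda>u. f (LX # u)) (\<lambda>u. f (LY # u)) \<in> T"
        using f T by (intro fscale.subspace_add[OF T(2)]) blast+
      ultimately show "f \<in> T" by simp
    qed
  qed
  finally show ?thesis .
qed

lemma xy_in_uspace_tensor:
  "fscale.subspace (uspace N) \<Longrightarrow> a \<in> uspace N \<Longrightarrow> b \<in> uspace N \<Longrightarrow> xy a b \<in> uspace VN"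
  by (simp add: uspace_tensor del: plus_fun_apply)

lemma xy_eq: "xy a b = xy a' b' \<longleftrightarrow> a = a' \<and> b = b'"
  by (metis xy_apply(2,3) ext)

lemma xy_arith:
  "xy a b + xy a' b' = xy (a + a') (b + b')" "- xy a b = xy (- a) (- b)"
  "xy a b - xy a' b' = xy (a - a') (b - b')" "fscale c (xy a b) = xy (fscale c a) (fscale c b)"
  by (rule xy_cong; simp add: fscale_def tens_def xvec_def yvec_def)+

lemma xy_eq_0: "xy a b = 0 \<longleftrightarrow> a = 0 \<and> b = 0"
  using xy_eq[of a b 0 0] by (simp add: tens_def fun_eq_iff split: list.splits)

text \<open>
  The relations for the coproduct.  In \<open>EF + FE\<close> the mixed terms cancel because \<open>Sig\<close> anticommutes
  with \<open>E\<close> and \<open>F\<close>, while \<open>K\<close> commutes with them; what is left is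
  \<open>[K] \<otimes> K\<^sup>-\<^sup>1 + K \<otimes> [K] = [K \<otimes> K]\<close>, where \<open>[K] = (K - K\<^sup>-\<^sup>1) / (q - q\<^sup>-\<^sup>1)\<close>.
\<close>

lemma Uq_module_tensor:
  assumes N: "Uq_module q fscale N" and q: "q \<noteq> 0" "q - inverse q \<noteq> 0"
  shows "Uq_module q fscale VN"
proof -
  interpret N: quantum_module fscale q N by unfold_locales (rule N)
  note S = N.sub_uspace
  have xyE: "\<exists>a b. a \<in> uspace N \<and> b \<in> uspace N \<and> f = xy a b" if "f \<in> uspace VN" for f
  proof (intro exI conjI)
    show "f = xy (\<lambda>u. f (LX # u)) (\<lambda>u. f (LY # u))"
      using that by (intro xy_cong) (simp_all add: uspace_tensor[OF S])
  qed (use that in \<open>simp_all add: uspace_tensor[OF S]\<close>)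
  note U = fscale.subspace_add[OF S] fscale.subspace_scale[OF S]
    fscale.subspace_neg[OF S] fscale.subspace_diff[OF S] N.act_closed
  note act_xy = act_tensor[where f = "xy a b" for a b, unfolded xy_apply]
  have sub: "fscale.subspace (uspace VN)"
    by (simp add: tens_module_def)
  have closed: "act VN g v \<in> uspace VN" if v: "v \<in> uspace VN" for g v
  proof -
    obtain a b where "a \<in> uspace N" "b \<in> uspace N" "v = xy a b"
      using xyE[OF v] by blast
    then show ?thesis
      by (cases g) (simp_all only: act_xy, (intro xy_in_uspace_tensor[OF S] U; assumption)+)
  qed
  have add: "act VN g (v + w) = act VN g v + act VN g w" if vw: "v \<in> uspace VN" "w \<in> uspace VN" for g v w
  proof -
    obtain a b a' b' where "a \<in> uspace N" "b \<in> uspace N" "v = xy a b"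
        "a' \<in> uspace N" "b' \<in> uspace N" "w = xy a' b'"
      using xyE[OF vw(1)] xyE[OF vw(2)] by blast
    then show ?thesis
      by (cases g) (simp_all only: xy_arith act_xy N.act_add xy_eq, auto simp: fun_eq_iff fscale_def algebra_simps)
  qed
  have scale: "act VN g (fscale c v) = fscale c (act VN g v)" if v: "v \<in> uspace VN" for g c v
  proof -
    obtain a b where "a \<in> uspace N" "b \<in> uspace N" "v = xy a b"
      using xyE[OF v] by blast
    then show ?thesis
      by (cases g) (simp_all only: xy_arith act_xy N.act_scale xy_eq, auto simp: fun_eq_iff fscale_def algebra_simps)
  qed
  have rel: "act VN (Q 0) v = v"
    "act VN (Q h) (act VN (Q h') v) = act VN (Q (h + h')) v"
    "act VN (Q h) (act VN E v) = fscale (q powi pairing h alpha) (act VN E (act VN (Q h) v))"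
    "act VN (Q h) (act VN F v) = fscale (q powi (- pairing h alpha)) (act VN F (act VN (Q h) v))"
    "act VN E (act VN F v) + act VN F (act VN E v)
      = fscale (1 / (q - inverse q)) (act VN K v - act VN Kinv v)"
    "act VN E (act VN E v) = 0" "act VN F (act VN F v) = 0"
    "act VN Sig (act VN E v) = - act VN E (act VN Sig v)"
    "act VN Sig (act VN F v) = - act VN F (act VN Sig v)"
    "act VN Sig (act VN (Q h) v) = act VN (Q h) (act VN Sig v)"
    "act VN Sig (act VN Sig v) = v"
    if v': "v \<in> uspace VN" for v h h'
  proof -
    obtain a b where a: "a \<in> uspace N" and b: "b \<in> uspace N" and v: "v = xy a b"
      using xyE[OF v'] by blast
    note rules = v act_xy xy_arith N.act_add N.act_scale N.act_neg N.act_diff U a b xy_eq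
    have Kinv: "act N Kinv (act N E c) = act N E (act N Kinv c)"
      "act N Kinv (act N F c) = act N F (act N Kinv c)" if "c \<in> uspace N" for c
      using that by (simp_all add: N.Q_E N.Q_F h1_def h2_def pairing_def alpha_def eps1_def eps2_def)
    show "act VN (Q 0) v = v"
      by (simp only: rules N.Q_0) (simp add: fscale_def)
    show "act VN (Q h) (act VN (Q h') v) = act VN (Q (h + h')) v"
      using q by (simp only: rules N.Q_Q) (simp add: fscale_def power_int_add fun_eq_iff)
    show "act VN Sig (act VN Sig v) = v"
      by (simp only: rules N.Sig_Sig) simp
    show "act VN Sig (act VN (Q h) v) = act VN (Q h) (act VN Sig v)"
      by (simp only: rules N.Sig_Q) (simp add: fscale_def fun_eq_iff)
    show "act VN Sig (act VN F v) = - act VN F (act VN Sig v)"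
      by (simp only: rules N.Sig_F) (simp add: fscale_def fun_eq_iff)
    show "act VN Sig (act VN E v) = - act VN E (act VN Sig v)"
      by (simp only: rules N.Sig_E N.Sig_Q) (simp add: fscale_def fun_eq_iff)
    show "act VN F (act VN F v) = 0"
      by (simp only: rules xy_eq_0 N.F_F) (simp add: fscale_def fun_eq_iff)
    show "act VN E (act VN E v) = 0"
      by (simp only: rules xy_eq_0 N.E_E Kinv) (simp add: fscale_def fun_eq_iff)
    define d where "d = 1 / (q - inverse q)"
    \<comment> \<open>This says that \<open>[K]\<close> acts as the identity on \<open>x\<close> and \<open>y\<close>.\<close>
    have "d * (q - inverse q) = 1" using q(2) by (simp add: d_def)
    then have "d * q = 1 + d * inverse q" by (simp add: right_diff_distrib diff_eq_eq)
    then have d: "d * (q * c) = c + d * (inverse q * c)" for c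
      by (simp add: ring_distribs flip: mult.assoc)
    have EF: "act N E (act N F c) = fscale d (act N K c - act N Kinv c) - act N F (act N E c)"
      if "c \<in> uspace N" for c
      using N.EF_FE[OF that] by (simp add: d_def eq_diff_eq)
    show "act VN E (act VN F v) + act VN F (act VN E v)
      = fscale (1 / (q - inverse q)) (act VN K v - act VN Kinv v)"
      unfolding d_def[symmetric]
      by (simp only: rules Kinv EF)
        (simp add: fscale_def fun_eq_iff h1_def h2_def algebra_simps d power_int_minus)
    have alpha: "pairing h alpha = fst h - snd h"
      by (simp add: pairing_def alpha_def eps1_def eps2_def)
    show "act VN (Q h) (act VN E v) = fscale (q powi pairing h alpha) (act VN E (act VN (Q h) v))"
      using q by (simp only: rules N.Q_E N.Q_Q alpha)
        (simp add: fscale_def fun_eq_iff algebra_simps power_int_diff)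
    show "act VN (Q h) (act VN F v) = fscale (q powi (- pairing h alpha)) (act VN F (act VN (Q h) v))"
      using q by (simp only: rules N.Q_F alpha)
        (simp add: fscale_def fun_eq_iff algebra_simps power_int_diff)
  qed
  show ?thesis
    unfolding Uq_module_def
    by (intro conjI allI ballI vector_space_fscale sub closed add scale rel; assumption)
qed

end

section \<open>Words of letters\<close>

lemma sum_apply: "(\<Sum>i\<in>I. f i) x = (\<Sum>i\<in>I. f i x)"
  by (induction I rule: infinite_finite_induct) simp_all

lemma count_letters: "count_list w LX + count_list w LY = length w"
proof (induction w)
  case (Cons a w)
  then show ?case by (cases a) simp_all
qed simp

text \<open>
  Position \<open>i - 1\<close> of the word decides whether \<open>i\<close> belongs to \<open>S\<close>; the \<open>u_S\<close> are thus the
  standard basis vectors of the tensor power.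
\<close>

definition subset_word :: "nat \<Rightarrow> nat set \<Rightarrow> letter list" where
  "subset_word n S = map (\<lambda>i. if i \<in> S then LX else LY) [1..<Suc n]"

lemma length_subset_word [simp]: "length (subset_word n S) = n"
  by (simp add: subset_word_def)

lemma bij_subset_word: "bij_betw (subset_word n) (Pow {1..n}) {w. length w = n}"
proof (rule bij_betwI[where g = "\<lambda>w. {i \<in> {1..n}. w ! (i - 1) = LX}"])
  fix S assume "S \<in> Pow {1..n}"
  moreover have "subset_word n S ! (i - 1) = LX \<longleftrightarrow> i \<in> S" if "i \<in> {1..n}" for i
    using that by (auto simp: subset_word_def simp del: upt_Suc split: if_splits)
  ultimately show "{i \<in> {1..n}. subset_word n S ! (i - 1) = LX} = S" by blast
next
  fix w :: "letter list" assume "w \<in> {w. length w = n}"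
  then show "subset_word n {i \<in> {1..n}. w ! (i - 1) = LX} = w"
    by (intro nth_equalityI) (auto simp: subset_word_def simp del: upt_Suc intro: letter.exhaust)
qed auto

text \<open>A letter \<open>x\<close> contributes \<open>\<epsilon>1\<close> and a letter \<open>y\<close> contributes \<open>\<epsilon>2\<close> to the weight of \<open>u_S\<close>.\<close>

lemma count_subset_word:
  assumes "S \<subseteq> {1..n}"
  shows "count_list (subset_word n S) LX = card S"
    and "int (count_list (subset_word n S) LY) = int n - int (card S)"
proof -
  have "count_list (map (\<lambda>i. if i \<in> S then LX else LY) xs) LX = card (set xs \<inter> S)"
    if "distinct xs" for xs using that by (induction xs) auto
  then have "count_list (subset_word n S) LX = card ({1..<Suc n} \<inter> S)"
    unfolding subset_word_def by (metis distinct_upt set_upt)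
  also have "{1..<Suc n} \<inter> S = S" using assms by auto
  finally show X: "count_list (subset_word n S) LX = card S" .
  show "int (count_list (subset_word n S) LY) = int n - int (card S)"
    using count_letters[of "subset_word n S"] by (simp add: X)
qed

lemma u_vec_eq: "u_vec (Suc n) S = (\<lambda>w. if w = subset_word n S then 1 else 0)"
proof -
  have "foldr tens (map (\<lambda>i. if i \<in> S then xvec else yvec) xs) tens_one
      = (\<lambda>w. if w = map (\<lambda>i. if i \<in> S then LX else LY) xs then 1 else 0)" for xs
    by (induction xs) (auto simp: tens_one_def tens_def xvec_def yvec_def fun_eq_iff split: list.split)
  then show ?thesis by (simp add: u_vec_def subset_word_def del: upt_Suc)
qed

lemma tens_yvec: "tens yvec c = xy 0 c"
  by (simp add: tens_def fun_eq_iff split: list.splits)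

lemma u_vec_independent:
  assumes "(\<Sum>S\<in>Pow {1..n}. fscale (p S) (u_vec (Suc n) S)) = 0" and "S \<in> Pow {1..n}"
  shows "p S = 0"
proof -
  have "(\<Sum>S'\<in>Pow {1..n}. fscale (p S') (u_vec (Suc n) S')) (subset_word n S)
      = (\<Sum>S'\<in>Pow {1..n}. if S = S' then p S' else 0)"
    unfolding sum_apply using assms(2) bij_subset_word[of n]
    by (intro sum.cong) (auto simp: fscale_def u_vec_eq bij_betw_def inj_on_def)
  then show ?thesis using assms by simp
qed

section \<open>Tensor powers of the natural module\<close>

lemma uspace_trivial: "uspace trivial_module = {f. \<forall>w. w \<noteq> [] \<longrightarrow> f w = 0}"
proof -
  have "f \<in> range (\<lambda>c. fscale c tens_one)" if "\<forall>w. w \<noteq> [] \<longrightarrow> f w = 0" for f :: "'a list \<Rightarrow> complex"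
    using that by (intro range_eqI[of _ _ "f []"]) (auto simp: fscale_def tens_one_def fun_eq_iff)
  then show ?thesis
    by (auto simp: trivial_module_def fscale.span_singleton fscale_def tens_one_def)
qed

lemma Uq_module_trivial: "Uq_module q fscale (trivial_module :: (letter list \<Rightarrow> complex) Uq_mod)"
proof -
  have "fscale.subspace (uspace (trivial_module :: (letter list \<Rightarrow> complex) Uq_mod))"
    by (simp add: trivial_module_def)
  moreover have "act trivial_module g v \<in> uspace trivial_module"
    if "v \<in> uspace trivial_module" for g and v :: "letter list \<Rightarrow> complex"
    using that unfolding uspace_trivial by (cases g) (auto simp: trivial_module_def)
  moreover have "act trivial_module g (v + w) = act trivial_module g v + act trivial_module g w"
    "act trivial_module g (fscale c v) = fscale c (act trivial_module g v)"
    for g c and v w :: "letter list \<Rightarrow> complex"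
    by (cases g; simp add: trivial_module_def fscale_def fun_eq_iff)+
  ultimately show ?thesis
    unfolding Uq_module_def
    by (auto simp: vector_space_fscale) (simp_all add: trivial_module_def fscale_def fun_eq_iff)
qed

text \<open>In this setting every \<open>[n]\<close> with \<open>n \<ge> 1\<close> is nonzero.\<close>

locale generic_parameter =
  fixes q :: complex
  assumes q_nonzero: "q \<noteq> 0" and not_root: "\<And>n::nat. n \<ge> 1 \<Longrightarrow> q ^ n \<noteq> 1"
begin

lemma q_powi_neq: "n \<ge> 1 \<Longrightarrow> q powi int n \<noteq> q powi (- int n)"
  using not_root[of "n + n"] q_nonzero by (simp add: power_int_minus power_add field_simps)

lemma q_diff_nonzero: "q - inverse q \<noteq> 0"
  using q_powi_neq[of 1] by simp

lemma q_number_nonzero: "n \<ge> 1 \<Longrightarrow> q_number q (int n) \<noteq> 0"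
  using q_powi_neq q_diff_nonzero by (simp add: q_number_def)

lemma Uq_module_tensor_power: "Uq_module q fscale (tensor_power q k)"
  by (induction k) (simp_all add: Uq_module_trivial Uq_module_tensor[OF _ q_nonzero q_diff_nonzero])

sublocale tp: quantum_module fscale q "tensor_power q k" for k
  by unfold_locales (rule Uq_module_tensor_power)

lemma uspace_tensor_power: "uspace (tensor_power q k) = {f. \<forall>w. length w \<noteq> k \<longrightarrow> f w = 0}"
proof (induction k)
  case (Suc k)
  show ?case
    unfolding tensor_power.simps uspace_tensor[OF tp.sub_uspace[of k]] Suc
  proof (intro Collect_cong iffI allI impI)
    fix f :: "letter list \<Rightarrow> complex" and w :: "letter list"
    assume f: "f [] = 0 \<and> (\<lambda>u. f (LX # u)) \<in> {f. \<forall>w. length w \<noteq> k \<longrightarrow> f w = 0} \<and>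
      (\<lambda>u. f (LY # u)) \<in> {f. \<forall>w. length w \<noteq> k \<longrightarrow> f w = (0::complex)}" and "length w \<noteq> Suc k"
    then show "f w = 0" by (cases w rule: word_split_cases) auto
  qed auto
qed (simp add: uspace_trivial)

lemma act_Q_tensor_power:
  assumes "f \<in> uspace (tensor_power q k)"
  shows "act (tensor_power q k) (Q h) f
       = (\<lambda>w. q powi pairing h (int (count_list w LX), int (count_list w LY)) * f w)"
  using assms
proof (induction k arbitrary: f)
  case 0
  then have "f w = 0" if "w \<noteq> []" for w using that by (simp add: uspace_trivial)
  then have "f = (\<lambda>w. q powi pairing h (int (count_list w LX), int (count_list w LY)) * f w)"
    by (intro ext) (case_tac "w = []"; simp add: pairing_def)
  from trans[OF _ this] show ?case by (simp add: trivial_module_def)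
next
  case (Suc k)
  then have f: "f [] = 0" "(\<lambda>u. f (LX # u)) \<in> uspace (tensor_power q k)"
      "(\<lambda>u. f (LY # u)) \<in> uspace (tensor_power q k)"
    by (auto simp: uspace_tensor_power simp del: tensor_power.simps)
  show ?case
    unfolding tensor_power.simps act_tensor_Q Suc.IH[OF f(2)] Suc.IH[OF f(3)]
    by (rule sym, rule xy_cong)
      (simp_all add: f(1) fscale_def pairing_def algebra_simps power_int_add q_nonzero)
qed

lemma act_Sig_tensor_power:
  assumes "f \<in> uspace (tensor_power q k)"
  shows "act (tensor_power q k) Sig f = (\<lambda>w. (-1) powi int (count_list w LY) * f w)"
  using assms
proof (induction k arbitrary: f)
  case 0
  then have "f w = 0" if "w \<noteq> []" for w using that by (simp add: uspace_trivial)
  then have "f = (\<lambda>w. (-1) powi int (count_list w LY) * f w)"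
    by (intro ext) (case_tac "w = []"; simp)
  from trans[OF _ this] show ?case by (simp add: trivial_module_def)
next
  case (Suc k)
  then have f: "f [] = 0" "(\<lambda>u. f (LX # u)) \<in> uspace (tensor_power q k)"
      "(\<lambda>u. f (LY # u)) \<in> uspace (tensor_power q k)"
    by (auto simp: uspace_tensor_power simp del: tensor_power.simps)
  show ?case
    unfolding tensor_power.simps act_tensor_Sig Suc.IH[OF f(2)] Suc.IH[OF f(3)]
    by (rule sym, rule xy_cong) (simp_all add: f(1) power_int_add)
qed

text \<open>A word of length \<open>k\<close> has \<open>k\<close> letters \<open>x\<close> and \<open>y\<close> in total, whence the scalar \<open>q^k\<close>.\<close>

lemma act_K_tensor_power:
  assumes f: "f \<in> uspace (tensor_power q k)"
  shows "act (tensor_power q k) K f = fscale (q powi int k) f"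
    and "act (tensor_power q k) Kinv f = fscale (q powi (- int k)) f"
proof -
  have *: "f w = 0 \<or> int (count_list w LX) + int (count_list w LY) = int k" for w
    using f count_letters[of w] by (auto simp: uspace_tensor_power simp flip: of_nat_add)
  show "act (tensor_power q k) K f = fscale (q powi int k) f"
    unfolding act_Q_tensor_power[OF f]
  proof
    fix w show "q powi pairing (h1 + h2) (int (count_list w LX), int (count_list w LY)) * f w
        = fscale (q powi int k) f w"
      using *[of w] by (auto simp: fscale_def h1_def h2_def pairing_def simp del: power_int_of_nat)
  qed
  show "act (tensor_power q k) Kinv f = fscale (q powi (- int k)) f"
    unfolding act_Q_tensor_power[OF f]
  proof
    fix w
    have "pairing (- (h1 + h2)) (int (count_list w LX), int (count_list w LY))
        = - (int (count_list w LX) + int (count_list w LY))"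
      by (simp add: h1_def h2_def pairing_def)
    then show "q powi pairing (- (h1 + h2)) (int (count_list w LX), int (count_list w LY)) * f w
        = fscale (q powi (- int k)) f w"
      using *[of w] by (elim disjE) (simp_all only: fscale_def mult_zero_right)
  qed
qed

lemma EF_FE_tensor_power:
  assumes "f \<in> uspace (tensor_power q k)"
  shows "act (tensor_power q k) E (act (tensor_power q k) F f)
       + act (tensor_power q k) F (act (tensor_power q k) E f) = fscale (q_number q (int k)) f"
  unfolding tp.EF_FE[OF assms] act_K_tensor_power[OF assms]
  by (simp add: fun_eq_iff fscale_def q_number_def left_diff_distrib diff_divide_distrib)

lemma tens_yvec_in_uspace:
  "c \<in> uspace (tensor_power q n) \<Longrightarrow> tens yvec c \<in> uspace (tensor_power q (Suc n))"
  by (subst tens_yvec, unfold tensor_power.simps, intro xy_in_uspace_tensor tp.sub_uspace fscale.subspace_0[OF tp.sub_uspace])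

text \<open>The index of \<open>u_vec\<close> is that of the power containing \<open>v_S\<close>: it has one factor less.\<close>

lemma u_vec_in_uspace: "u_vec (Suc n) S \<in> uspace (tensor_power q n)"
  by (auto simp: uspace_tensor_power u_vec_eq)

lemma E_tens_yvec:
  assumes "c \<in> uspace (tensor_power q n)"
  shows "act (tensor_power q (Suc n)) E (tens yvec c)
    = xy (fscale (q powi (- int n)) c) (- act (tensor_power q n) E c)"
proof -
  \<comment> \<open>A single application of \<open>tens_yvec\<close>, whose right-hand side contains its left-hand side.\<close>
  have "act (tensor_power q (Suc n)) E (tens yvec c) = act (tensor_power q (Suc n)) E (xy 0 c)"
    by (rule arg_cong[OF tens_yvec])
  also have "\<dots> = xy (fscale (q powi (- int n)) c) (- act (tensor_power q n) E c)"
    unfolding tensor_power.simps act_tensor_E[where f = "xy 0 c", unfolded xy_apply]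
    by (simp only: tp.act_zero act_K_tensor_power[OF assms] add_0_right)
  finally show ?thesis .
qed

text \<open>
  The \<open>x\<close>-component of \<open>E (y \<otimes> c)\<close> is a nonzero multiple of \<open>c\<close>, so \<open>c\<close> can be read off.
\<close>

lemma E_tens_yvec_eq_0D:
  assumes "c \<in> uspace (tensor_power q n)" "act (tensor_power q (Suc n)) E (tens yvec c) = 0"
  shows "c = 0"
proof -
  have "fscale (q powi (- int n)) c = 0"
    using assms(2) unfolding E_tens_yvec[OF assms(1)] xy_eq_0 by blast
  with q_nonzero show ?thesis by simp
qed

text \<open>
  Since \<open>E\<^sup>2 = 0\<close>, the vector \<open>E (x \<otimes> a) = x \<otimes> E a\<close> equals \<open>E (y \<otimes> q^n E a)\<close>: the scalar
  cancels the \<open>q^(-n)\<close> by which \<open>K\<^sup>-\<^sup>1\<close> acts in the second factor.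
\<close>

lemma image_E:
  assumes "f \<in> uspace (tensor_power q (Suc n))"
  shows "\<exists>c\<in>uspace (tensor_power q n). act (tensor_power q (Suc n)) E f
           = act (tensor_power q (Suc n)) E (tens yvec c)"
proof -
  let ?T = "tensor_power q (Suc n)" and ?N = "tensor_power q n"
  define a b where "a = (\<lambda>u. f (LX # u))" and "b = (\<lambda>u. f (LY # u))"
  have a: "a \<in> uspace ?N" and b: "b \<in> uspace ?N"
    using assms by (auto simp: a_def b_def uspace_tensor_power simp del: tensor_power.simps)
  define c where "c = b + fscale (q powi int n) (act ?N E a)"
  have c: "c \<in> uspace ?N"
    unfolding c_def using a b
    by (intro fscale.subspace_add fscale.subspace_scale tp.sub_uspace tp.act_closed)
  have "act ?T E f = xy (fscale (q powi (- int n)) b + act ?N E a) (- act ?N E b)"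
    unfolding tensor_power.simps act_tensor_E a_def[symmetric] b_def[symmetric]
      act_K_tensor_power(2)[OF b] ..
  also have "\<dots> = act ?T E (tens yvec c)"
    unfolding E_tens_yvec[OF c] xy_eq
  proof
    show "fscale (q powi - int n) b + act ?N E a = fscale (q powi - int n) c"
      using q_nonzero by (simp add: c_def fscale.scale_right_distrib del: power_int_of_nat flip: power_int_add)
    have "act ?N E c = act ?N E b + fscale (q powi int n) (act ?N E (act ?N E a))"
      unfolding c_def using a b
      by (simp only: tp.act_add tp.act_scale tp.act_closed fscale.subspace_scale[OF tp.sub_uspace])
    then show "- act ?N E b = - act ?N E c" by (simp add: tp.E_E[OF a])
  qed
  finally show ?thesis using c by blast
qed

lemma u_vec_expansion:
  assumes "c \<in> uspace (tensor_power q n)"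
  shows "c = (\<Sum>S\<in>Pow {1..n}. fscale (c (subset_word n S)) (u_vec (Suc n) S))"
proof
  fix w
  have "(\<Sum>S\<in>Pow {1..n}. fscale (c (subset_word n S)) (u_vec (Suc n) S)) w
      = (\<Sum>S\<in>Pow {1..n}. if w = subset_word n S then c (subset_word n S) else 0)"
    unfolding sum_apply by (intro sum.cong) (simp_all add: fscale_def u_vec_eq)
  also have "\<dots> = (\<Sum>v\<in>{w. length w = n}. if w = v then c v else 0)"
    by (rule sum.reindex_bij_betw[OF bij_subset_word])
  also have "finite {w :: letter list. length w = n}"
    using bij_betw_finite[OF bij_subset_word, of n] by simp
  then have "(\<Sum>v\<in>{w. length w = n}. if w = v then c v else 0) = c w"
    using assms by (simp add: uspace_tensor_power)
  finally show "c w = (\<Sum>S\<in>Pow {1..n}. fscale (c (subset_word n S)) (u_vec (Suc n) S)) w" ..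
qed

section \<open>The decomposition\<close>

lemma v_vec_in_uspace: "v_vec q (Suc n) S \<in> uspace (tensor_power q (Suc n))"
  unfolding v_vec_def by (intro tp.act_closed tens_yvec_in_uspace u_vec_in_uspace)

text \<open>
  The vector \<open>y \<otimes> u_S\<close> has weight \<open>(|S|, n - |S| + 1)\<close>, and \<open>E\<close> turns one \<open>y\<close> into an \<open>x\<close>.
\<close>

lemma highest_weight_v_vec:
  assumes S: "S \<subseteq> {1..n}"
  shows "highest_weight_vector q fscale (int (card S) + 1) (int n - int (card S))
    (tensor_power q (Suc n)) (v_vec q (Suc n) S)"
proof -
  let ?T = "tensor_power q (Suc n)" and ?y = "tens yvec (u_vec (Suc n) S)"
  have y: "?y \<in> uspace ?T" by (intro tens_yvec_in_uspace u_vec_in_uspace)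
  have y_supp: "?y w = 0 \<or> w = LY # subset_word n S" for w
    by (cases w) (auto simp: tens_def u_vec_eq yvec_def)
  have Qy: "act ?T (Q h) ?y = fscale (q powi pairing h (int (card S), int n - int (card S) + 1)) ?y" for h
    unfolding act_Q_tensor_power[OF y]
  proof
    fix w show "q powi pairing h (int (count_list w LX), int (count_list w LY)) * ?y w
      = fscale (q powi pairing h (int (card S), int n - int (card S) + 1)) ?y w"
      using y_supp[of w] count_subset_word[OF S] by (auto simp: fscale_def add.commute)
  qed
  have Q: "act ?T (Q h) (act ?T E ?y)
      = fscale (q powi (pairing h alpha + pairing h (int (card S), int n - int (card S) + 1)))
          (act ?T E ?y)" for h
    using q_nonzero
    by (simp only: tp.Q_E[OF y] Qy tp.act_scale[OF y] fscale.scale_scale power_int_add simp_thms)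
  have Sigy: "act ?T Sig ?y = fscale (- ((-1) powi (int n - int (card S)))) ?y"
    unfolding act_Sig_tensor_power[OF y]
  proof
    fix w show "(- 1) powi int (count_list w LY) * ?y w
      = fscale (- ((-1) powi (int n - int (card S)))) ?y w"
      using y_supp[of w] count_subset_word[OF S]
      by (auto simp: fscale_def power_int_add simp del: power_int_of_nat)
  qed
  have Sig: "act ?T Sig (act ?T E ?y) = fscale ((-1) powi (int n - int (card S))) (act ?T E ?y)"
    by (simp only: tp.Sig_E[OF y] Sigy tp.act_scale[OF y]) simp
  have "u_vec (Suc n) S \<noteq> 0" by (auto simp: u_vec_eq fun_eq_iff)
  then have "act ?T E ?y \<noteq> 0" using E_tens_yvec_eq_0D[OF u_vec_in_uspace] by blast
  moreover have "pairing h1 alpha = 1" "pairing h2 alpha = -1"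
    "pairing h1 (a, b) = a" "pairing h2 (a, b) = b" for a b
    by (simp_all add: pairing_def h1_def h2_def alpha_def eps1_def eps2_def)
  ultimately show ?thesis
    unfolding highest_weight_vector_def
    using v_vec_in_uspace[of n S] Q[of h1] Q[of h2] Sig tp.E_E[OF y]
    by (simp add: v_vec_def add.commute del: tensor_power.simps)
qed

lemma uspace_V_sub:
  "uspace (V_sub q (Suc n) S) = range (weight_comb fscale (tensor_power q (Suc n)) (v_vec q (Suc n) S))"
  by (simp add: V_sub_def tp.range_weight_comb del: tensor_power.simps)

lemma uspace_V_sub_subset: "uspace (V_sub q (Suc n) S) \<subseteq> uspace (tensor_power q (Suc n))"
  unfolding uspace_V_sub by (intro image_subsetI tp.weight_comb_closed v_vec_in_uspace)

lemma V_sub_Lq: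
  assumes "S \<subseteq> {1..n}"
  shows "is_Lq q fscale (int (card S) + 1) (int n - int (card S)) (V_sub q (Suc n) S)"
  unfolding V_sub_def
  using highest_weight_v_vec[OF assms] q_nonzero q_number_nonzero[of "Suc n"]
  by (intro tp.span_highest_weight_vector) (auto simp: add.commute simp del: tensor_power.simps)

lemma E_tens_yvec_sum:
  "(\<Sum>S\<in>Pow {1..n}. fscale (p S) (v_vec q (Suc n) S))
    = act (tensor_power q (Suc n)) E (tens yvec (\<Sum>S\<in>Pow {1..n}. fscale (p S) (u_vec (Suc n) S)))"
proof -
  let ?T = "tensor_power q (Suc n)"
  have "tens yvec (\<Sum>S\<in>Pow {1..n}. fscale (p S) (u_vec (Suc n) S))
      = (\<Sum>S\<in>Pow {1..n}. fscale (p S) (tens yvec (u_vec (Suc n) S)))"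
    by (rule ext) (simp add: tens_def sum_apply fscale_def sum_distrib_left algebra_simps split: list.split)
  moreover have "act ?T E (\<Sum>S\<in>Pow {1..n}. fscale (p S) (tens yvec (u_vec (Suc n) S)))
      = (\<Sum>S\<in>Pow {1..n}. act ?T E (fscale (p S) (tens yvec (u_vec (Suc n) S))))"
    by (intro tp.act_sum fscale.subspace_scale tp.sub_uspace tens_yvec_in_uspace u_vec_in_uspace)
  ultimately show ?thesis
    by (simp only: v_vec_def tp.act_scale[OF tens_yvec_in_uspace[OF u_vec_in_uspace]])
qed

lemma weight_comb_sum:
  "(\<Sum>S\<in>Pow {1..n}. weight_comb fscale (tensor_power q (Suc n)) (v_vec q (Suc n) S) (p S))
    = (\<Sum>S\<in>Pow {1..n}. fscale (fst (p S)) (v_vec q (Suc n) S))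
    + act (tensor_power q (Suc n)) F (\<Sum>S\<in>Pow {1..n}. fscale (snd (p S)) (v_vec q (Suc n) S))"
  unfolding weight_comb_def sum.distrib
  by (subst tp.act_sum)
    (auto simp: tp.act_scale v_vec_in_uspace fscale.subspace_scale tp.sub_uspace
      simp del: tensor_power.simps)

text \<open>Applying \<open>E\<close> to the relation leaves \<open>E F E (y \<otimes> b) = [n + 1] E (y \<otimes> b)\<close>.\<close>

lemma E_tens_yvec_independent:
  assumes a: "a \<in> uspace (tensor_power q n)" and b: "b \<in> uspace (tensor_power q n)"
    and eq: "act (tensor_power q (Suc n)) E (tens yvec a)
      + act (tensor_power q (Suc n)) F (act (tensor_power q (Suc n)) E (tens yvec b)) = 0"
  shows "a = 0" "b = 0"
proof -
  let ?T = "tensor_power q (Suc n)"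
  let ?a = "act ?T E (tens yvec a)" and ?b = "act ?T E (tens yvec b)"
  have U: "tens yvec a \<in> uspace ?T" "tens yvec b \<in> uspace ?T"
    using a b by (simp_all only: tens_yvec_in_uspace)
  have bU: "?b \<in> uspace ?T" using U(2) by (rule tp.act_closed)
  have "0 = act ?T E (?a + act ?T F ?b)" unfolding eq tp.act_zero ..
  also have "\<dots> = act ?T E (act ?T F ?b) + act ?T F (act ?T E ?b)"
    by (simp only: tp.act_add[OF tp.act_closed[OF U(1)] tp.act_closed[OF bU]] tp.E_E[OF U(1)]
        tp.E_E[OF U(2)] tp.act_zero add_0_left add_0_right)
  also have "\<dots> = fscale (q_number q (int (Suc n))) ?b"
    by (rule EF_FE_tensor_power[OF bU])
  finally have "?b = 0"
    using q_number_nonzero[of "Suc n"] fscale.scale_eq_0_iff by (metis le_add1 plus_1_eq_Suc)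
  then show "b = 0" by (rule E_tens_yvec_eq_0D[OF b])
  from \<open>?b = 0\<close> eq have "?a = 0" by (simp only: tp.act_zero add_0_right)
  then show "a = 0" by (rule E_tens_yvec_eq_0D[OF a])
qed

text \<open>
  With \<open>g = [n + 1]\<^sup>-\<^sup>1 f\<close> the relation \<open>EF + FE = [n + 1]\<close> reads \<open>f = E (F g) + F (E g)\<close>, and both
  \<open>E (F g)\<close> and \<open>E g\<close> have the form \<open>E (y \<otimes> c)\<close>.
\<close>

lemma E_tens_yvec_generate:
  assumes f: "f \<in> uspace (tensor_power q (Suc n))"
  obtains a b where "a \<in> uspace (tensor_power q n)" "b \<in> uspace (tensor_power q n)"
    "f = act (tensor_power q (Suc n)) E (tens yvec a)
      + act (tensor_power q (Suc n)) F (act (tensor_power q (Suc n)) E (tens yvec b))"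
proof -
  let ?T = "tensor_power q (Suc n)" and ?c = "q_number q (int (Suc n))"
  define g where "g = fscale (inverse ?c) f"
  have g: "g \<in> uspace ?T" unfolding g_def by (intro fscale.subspace_scale tp.sub_uspace f)
  have "?c \<noteq> 0" using q_number_nonzero[of "Suc n"] by (simp del: of_nat_Suc)
  then have "f = fscale ?c g" by (simp add: g_def del: of_nat_Suc)
  also have "\<dots> = act ?T E (act ?T F g) + act ?T F (act ?T E g)"
    by (rule EF_FE_tensor_power[OF g, symmetric])
  finally show thesis
    using image_E[OF tp.act_closed[OF g, of F]] image_E[OF g] that by metis
qed

lemma sum_u_vec_in_uspace:
  "(\<Sum>S\<in>Pow {1..n}. fscale (c S) (u_vec (Suc n) S)) \<in> uspace (tensor_power q n)"
  by (intro fscale.subspace_sum fscale.subspace_scale tp.sub_uspace u_vec_in_uspace)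

theorem tensor_power_internal_direct_sum:
  "internal_direct_sum (uspace (tensor_power q (Suc n))) (Pow {1..n}) (\<lambda>S. uspace (V_sub q (Suc n) S))"
proof (rule internal_direct_sumI[OF vector_space_fscale])
  let ?T = "tensor_power q (Suc n)"
  let ?comb = "\<lambda>S. weight_comb fscale ?T (v_vec q (Suc n) S)"
  show "fscale.subspace (uspace (V_sub q (Suc n) S))" for S by (simp add: V_sub_def)
  have coord: "\<exists>p. \<forall>S\<in>Pow {1..n}. w S = ?comb S (p S)"
    if "w \<in> (\<Pi> S\<in>Pow {1..n}. uspace (V_sub q (Suc n) S))" for w
    using that unfolding uspace_V_sub by (intro bchoice) blast
  fix w assume w: "w \<in> (\<Pi> S\<in>Pow {1..n}. uspace (V_sub q (Suc n) S))"
  show "sum w (Pow {1..n}) \<in> uspace ?T"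
    using w uspace_V_sub_subset by (intro fscale.subspace_sum[OF tp.sub_uspace]) blast
  assume 0: "sum w (Pow {1..n}) = 0"
  obtain p where p: "\<forall>S\<in>Pow {1..n}. w S = ?comb S (p S)" using coord[OF w] by blast
  with 0 have "(\<Sum>S\<in>Pow {1..n}. ?comb S (p S)) = 0" by (simp del: tensor_power.simps)
  note coord_0 = E_tens_yvec_independent[OF sum_u_vec_in_uspace sum_u_vec_in_uspace
      this[unfolded weight_comb_sum E_tens_yvec_sum]]
  have "fst (p S) = 0" "snd (p S) = 0" if "S \<in> Pow {1..n}" for S
    using u_vec_independent[OF coord_0(1) that] u_vec_independent[OF coord_0(2) that] .
  then show "\<forall>S\<in>Pow {1..n}. w S = 0" using p by (simp add: weight_comb_def del: tensor_power.simps)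
next
  let ?T = "tensor_power q (Suc n)"
  let ?comb = "\<lambda>S. weight_comb fscale ?T (v_vec q (Suc n) S)"
  fix f assume "f \<in> uspace ?T"
  then obtain a b where a: "a \<in> uspace (tensor_power q n)" and b: "b \<in> uspace (tensor_power q n)"
    and f: "f = act ?T E (tens yvec a) + act ?T F (act ?T E (tens yvec b))"
    by (rule E_tens_yvec_generate)
  define p where "p S = (a (subset_word n S), b (subset_word n S))" for S
  have "f = (\<Sum>S\<in>Pow {1..n}. ?comb S (p S))"
    unfolding weight_comb_sum E_tens_yvec_sum p_def fst_conv snd_conv
      u_vec_expansion[OF a, symmetric] u_vec_expansion[OF b, symmetric] by (rule f)
  then show "\<exists>w\<in>\<Pi> S\<in>Pow {1..n}. uspace (V_sub q (Suc n) S). f = sum w (Pow {1..n})"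
    by (intro bexI[of _ "\<lambda>S. ?comb S (p S)"]) (auto simp: uspace_V_sub)
qed

end

text \<open>Number the subsets of each cardinality separately.\<close>

lemma bij_betw_choose_subsets:
  assumes "finite A"
  obtains b where "bij_betw b (SIGMA l:{..card A}. {..<card A choose l}) (Pow A)"
    "\<And>l j. l \<le> card A \<Longrightarrow> j < card A choose l \<Longrightarrow> card (b (l, j)) = l"
proof -
  have "\<exists>h. bij_betw h {..<card A choose l} {S. S \<subseteq> A \<and> card S = l}" for l
    using assms by (intro finite_same_card_bij) (simp_all add: n_subsets)
  then obtain h where h: "\<And>l. bij_betw (h l) {..<card A choose l} {S. S \<subseteq> A \<and> card S = l}"
    by metis
  let ?I = "SIGMA l:{..card A}. {..<card A choose l}"
  have sub: "h l j \<subseteq> A" "card (h l j) = l" if "j < card A choose l" for l j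
    using h[of l] that unfolding bij_betw_def by auto
  have "bij_betw (\<lambda>(l, j). h l j) ?I (Pow A)"
  proof (rule bij_betw_imageI)
    show "inj_on (\<lambda>(l, j). h l j) ?I"
    proof (intro inj_onI; clarsimp)
      fix l j l' j' assume *: "j < card A choose l" "j' < card A choose l'" "h l j = h l' j'"
      then have "l = l'" using sub(2) by metis
      with * h[of l] show "l = l' \<and> j = j'" by (auto simp: bij_betw_def inj_on_def)
    qed
    show "(\<lambda>(l, j). h l j) ` ?I = Pow A"
    proof (intro equalityI subsetI)
      fix S assume "S \<in> Pow A"
      then have "card S \<le> card A" "S \<in> {S'. S' \<subseteq> A \<and> card S' = card S}"
        using assms by (auto simp: card_mono)
      moreover from this obtain j where "j < card A choose card S" "S = h (card S) j"
        using h[of "card S"] unfolding bij_betw_def by (metis (no_types, lifting) imageE lessThan_iff)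
      ultimately show "S \<in> (\<lambda>(l, j). h l j) ` ?I"
        by (intro image_eqI[of _ _ "(card S, j)"]) auto
    qed (use sub(1) in auto)
  qed
  with sub(2) show thesis by (intro that[of "\<lambda>(l, j). h l j"]) auto
qed

theorem theorem6p4:
  fixes q :: complex and k :: nat
  assumes "k \<ge> 1" and "q \<noteq> 0" and "\<forall>n::nat. n \<ge> 1 \<longrightarrow> q ^ n \<noteq> 1"
  shows "(\<forall>S \<subseteq> {1..k - 1}. Uq_irreducible q fscale (V_sub q k S))
    \<and> internal_direct_sum (uspace (tensor_power q k)) (Pow {1..k - 1}) (\<lambda>S. uspace (V_sub q k S))
    \<and> (\<forall>l<k. \<exists>M :: (letter list \<Rightarrow> complex) Uq_mod.
          is_Lq q fscale (int l + 1) (int k - 1 - int l) M)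
    \<and> (\<forall>(s :: complex \<Rightarrow> 'v::ab_group_add \<Rightarrow> 'v) (L :: nat \<Rightarrow> 'v Uq_mod).
          (\<forall>l<k. is_Lq q s (int l + 1) (int k - 1 - int l) (L l)) \<longrightarrow>
          Uq_isomorphic q fscale (tensor_power q k)
            (external_scale s :: complex \<Rightarrow> (nat \<times> nat \<Rightarrow> 'v) \<Rightarrow> nat \<times> nat \<Rightarrow> 'v)
            (external_direct_sum (SIGMA l:{..<k}. {..<(k - 1) choose l}) (\<lambda>(l, j). L l)))"
proof -
  interpret generic_parameter q using assms by unfold_locales auto
  obtain n where k: "k = Suc n" using \<open>k \<ge> 1\<close> by (cases k) auto
  have Lq: "is_Lq q fscale (int (card S) + 1) (int k - 1 - int (card S)) (V_sub q k S)"
    if "S \<subseteq> {1..k - 1}" for S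
    using V_sub_Lq[of S n] that by (simp add: k)
  have sum: "internal_direct_sum (uspace (tensor_power q k)) (Pow {1..k - 1})
      (\<lambda>S. uspace (V_sub q k S))"
    using tensor_power_internal_direct_sum[of n] by (simp add: k)
  have irr: "\<forall>S \<subseteq> {1..k - 1}. Uq_irreducible q fscale (V_sub q k S)"
    using Lq by (auto simp: is_Lq_def)
  have ex: "\<exists>M :: (letter list \<Rightarrow> complex) Uq_mod. is_Lq q fscale (int l + 1) (int k - 1 - int l) M"
    if "l < k" for l
  proof -
    have "{1..l} \<subseteq> {1..k - 1}" using that by auto
    from Lq[OF this] show ?thesis by auto
  qed
  have iso: "Uq_isomorphic q fscale (tensor_power q k) (external_scale s)
      (external_direct_sum (SIGMA l:{..<k}. {..<(k - 1) choose l}) (\<lambda>(l, j). L l))"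
    if L: "\<forall>l<k. is_Lq q s (int l + 1) (int k - 1 - int l) (L l)"
    for s :: "complex \<Rightarrow> 'v \<Rightarrow> 'v" and L
  proof -
    obtain b where b: "bij_betw b (SIGMA l:{..card {1..n}}. {..<card {1..n} choose l}) (Pow {1..n})"
      and card_b: "\<And>l j. l \<le> card {1..n} \<Longrightarrow> j < card {1..n} choose l \<Longrightarrow> card (b (l, j)) = l"
      using bij_betw_choose_subsets[of "{1..n}"] by blast
    let ?J = "SIGMA l:{..<k}. {..<(k - 1) choose l}"
    have bJ: "bij_betw b ?J (Pow {1..k - 1})"
      using b by (simp add: k lessThan_Suc_atMost)
    show ?thesis
    proof (rule isomorphic_external_direct_sum[OF Uq_module_tensor_power _ _
          internal_direct_sum_reindex[OF bJ sum]])
      show "vector_space s"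
        using L k by (auto simp: is_Lq_def Uq_irreducible_def Uq_module_def)
      show "finite ?J" by simp
      fix j assume j: "j \<in> ?J"
      then have bj: "b j \<subseteq> {1..k - 1}" using bJ by (auto simp: bij_betw_def)
      show "((\<lambda>S. uspace (V_sub q k S)) \<circ> b) j \<subseteq> uspace (tensor_power q k)"
        unfolding k comp_def by (rule uspace_V_sub_subset)
      obtain l i where li: "j = (l, i)" "l < k" "i < (k - 1) choose l" using j by auto
      then have "card (b j) = l" using card_b[of l i] by (simp add: k)
      moreover have "q_number q ((int l + 1) + (int k - 1 - int l)) \<noteq> 0"
        using q_number_nonzero[OF \<open>k \<ge> 1\<close>] by simp
      ultimately have "Uq_isomorphic q fscale (V_sub q k (b j)) s (L l)"
        using Lq[OF bj] L li q_nonzero by (intro Lq_unique) auto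
      moreover have "tensor_power q k\<lparr>uspace := uspace (V_sub q k (b j))\<rparr> = V_sub q k (b j)"
        by (simp add: V_sub_def)
      ultimately show "Uq_isomorphic q fscale
          (tensor_power q k\<lparr>uspace := ((\<lambda>S. uspace (V_sub q k S)) \<circ> b) j\<rparr>) s
          (case j of (l, j) \<Rightarrow> L l)"
        by (simp add: li)
    qed
  qed
  show ?thesis
    using irr sum ex iso by blast
qed

end
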